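(* Let $H$ be a Hopf algebra and let $A$ be a cleft Galois object of $H$. Then there is an invertible normalised 2-cocycle $\gamma:H\otimes H\to\mathbb{C}$ on $H$ such that $\mathcal{C}(A,H)$ is isomorphic to $H^{\gamma}$ as a Hopf algebra.
   Context: All algebras (unital, associative) and comodules are vector spaces over $\mathbb{C}$. $H$ is a Hopf algebra with coproduct $\Delta(h)=h_{(1)}\otimes h_{(2)}$ (sumless Sweedler notation), counit $\epsilon$, antipode $S$. A right $H$-comodule algebra is an algebra $A$ with a right $H$-coaction $\delta:A\to A\otimes H$, $\delta(a)=a_{(0)}\otimes a_{(1)}$, that is an algebra map. A Galois object of $H$ is a right $H$-comodule algebra $A$ with $A^{coH}=\{a\in A:\delta(a)=a\otimes1_H\}=\mathbb{C}$ and such that the canonical map $\chi:A\otimes A\to A\otimes H$, $a\otimes a'\mapsto aa'_{(0)}\otimes a'_{(1)}$ is bijective. It is cleft if there is a convolution invertible right $H$-comodule map $H\to A$. The translation map is $\tau(h)=\chi^{-1}(1\otimes h)\in A\otimes A$. $\mathcal{C}(A,H)=\{a\otimes\tilde a\in A\otimes A: a_{(0)}\otimes\tau(a_{(1)})\tilde a=a\otimes\tilde a\otimes1\}$ (summation over simple tensors suppressed), equivalently the elements of $A\otimes A$ coinvariant for the diagonal coaction, with product $(a\otimes\tilde a)(a'\otimes\tilde a')=aa'\otimes\tilde a'\tilde a$, unit $1\otimes1$, coproduct $\Delta(a\otimes\tilde a)=a_{(0)}\otimes\tau(a_{(1)})\otimes\tilde a$ and counit $\epsilon(a\otimes\tilde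 a)=a\tilde a\in\mathbb{C}$ (the Ehresmann–Schauenburg bialgebroid over the base $\mathbb{C}$). It is a known result of Schauenburg that for a Galois object $A$ this bialgebra is a Hopf algebra. An invertible normalised 2-cocycle on a Hopf algebra $H$ is a convolution invertible linear map $\gamma:H\otimes H\to\mathbb{C}$ with $\gamma(k_{(1)},m_{(1)})\gamma(h,k_{(2)}m_{(2)})=\gamma(h_{(1)},k_{(1)})\gamma(h_{(2)}k_{(2)},m)$ and $\gamma(1,h)=\epsilon(h)=\gamma(h,1)$ for all $h,k,m\in H$. $H^\gamma$ denotes the Hopf algebra with the same coalgebra structure as $H$ and product $h\cdot_\gamma g=\gamma(h_{(1)},g_{(1)})\,h_{(2)}g_{(2)}\,\gamma^{-1}(h_{(3)},g_{(3)})$. *)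

theory Defs
  imports Complex_Main "HOL-Library.Poly_Mapping"
begin

section \<open>Complex vector spaces\<close>

class complex_vector = ab_group_add +
  fixes scaleC :: "complex \<Rightarrow> 'a \<Rightarrow> 'a"  (infixr \<open>*\<^sub>C\<close> 75)
  assumes scaleC_add_right: "c *\<^sub>C (x + y) = c *\<^sub>C x + c *\<^sub>C y"
    and scaleC_add_left: "(c + d) *\<^sub>C x = c *\<^sub>C x + d *\<^sub>C x"
    and scaleC_scaleC: "c *\<^sub>C d *\<^sub>C x = (c * d) *\<^sub>C x"
    and scaleC_one: "1 *\<^sub>C x = x"

interpretation complex_vector: vector_space "scaleC :: complex \<Rightarrow> 'a \<Rightarrow> 'a::complex_vector"
  by unfold_locales (rule scaleC_add_right scaleC_add_left scaleC_scaleC scaleC_one)+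

instantiation complex :: complex_vector
begin
definition scaleC_complex_def [simp]: "c *\<^sub>C (z::complex) = c * z"
instance by standard (auto simp: algebra_simps)
end

text \<open>Linearity is only required on a subspace \<open>V\<close>; values outside \<open>V\<close> are irrelevant.\<close>

definition linear_on :: "'a::complex_vector set \<Rightarrow> ('a \<Rightarrow> 'b::complex_vector) \<Rightarrow> bool" where
  "linear_on V f \<longleftrightarrow>
     (\<forall>x\<in>V. \<forall>y\<in>V. f (x + y) = f x + f y) \<and> (\<forall>c. \<forall>x\<in>V. f (c *\<^sub>C x) = c *\<^sub>C f x)"

definition bilinear_on ::
  "'a::complex_vector set \<Rightarrow> 'b::complex_vector set \<Rightarrow> ('a \<Rightarrow> 'b \<Rightarrow> 'c::complex_vector) \<Rightarrow> bool" where
  "bilinear_on V W f \<longleftrightarrow>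
     (\<forall>x\<in>V. linear_on W (f x)) \<and> (\<forall>y\<in>W. linear_on V (\<lambda>x. f x y))"


section \<open>Tensor products over the complex numbers\<close>

text \<open>The free vector space on \<open>'a \<times> 'b\<close> is \<^typ>\<open>('a \<times> 'b) \<Rightarrow>\<^sub>0 complex\<close>. Since the generators
  below carry an arbitrary coefficient \<open>c\<close>, closure under addition already yields the subspace
  spanned by the usual bilinearity relations.\<close>

inductive_set tensor_relations :: "(('a::complex_vector \<times> 'b::complex_vector) \<Rightarrow>\<^sub>0 complex) set" where
  zero: "0 \<in> tensor_relations"
| plus: "p \<in> tensor_relations \<Longrightarrow> q \<in> tensor_relations \<Longrightarrow> p + q \<in> tensor_relations"
| add_left: "Poly_Mapping.single (x + x', y) c - Poly_Mapping.single (x, y) c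
     - Poly_Mapping.single (x', y) c \<in> tensor_relations"
| add_right: "Poly_Mapping.single (x, y + y') c - Poly_Mapping.single (x, y) c
     - Poly_Mapping.single (x, y') c \<in> tensor_relations"
| scale_left: "Poly_Mapping.single (s *\<^sub>C x, y) c - Poly_Mapping.single (x, y) (s * c) \<in> tensor_relations"
| scale_right: "Poly_Mapping.single (x, s *\<^sub>C y) c - Poly_Mapping.single (x, y) (s * c) \<in> tensor_relations"

lemma lookup_map_times [simp]:
  "Poly_Mapping.lookup (Poly_Mapping.map ((*) s) p) k = s * Poly_Mapping.lookup p (k::'k)" for s :: complex
  by (simp add: Poly_Mapping.map.rep_eq when_def)

lemma map_times_add: "Poly_Mapping.map ((*) s) (p + q) =
    Poly_Mapping.map ((*) s) p + Poly_Mapping.map ((*) s) q" for s :: complex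
  by (rule poly_mapping_eqI) (simp add: lookup_add algebra_simps)

lemma map_times_diff: "Poly_Mapping.map ((*) s) (p - q) =
    Poly_Mapping.map ((*) s) p - Poly_Mapping.map ((*) s) q" for s :: complex
  by (rule poly_mapping_eqI) (simp add: lookup_minus algebra_simps)

lemma map_times_single: "Poly_Mapping.map ((*) s) (Poly_Mapping.single k c) =
    Poly_Mapping.single k (s * c)" for s :: complex
  by (rule poly_mapping_eqI) (simp add: lookup_single when_def)

lemma tensor_relations_scale:
  "p \<in> tensor_relations \<Longrightarrow> Poly_Mapping.map ((*) s) p \<in> tensor_relations"
proof (induction rule: tensor_relations.induct)
  case zero
  have "Poly_Mapping.map ((*) s) 0 = (0 :: ('a \<times> 'b) \<Rightarrow>\<^sub>0 complex)"
    by (rule poly_mapping_eqI) simp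
  then show ?case by (simp add: tensor_relations.zero)
next
  case (plus p q)
  then show ?case by (simp add: map_times_add tensor_relations.plus)
next
  case (scale_left s' x y c)
  then show ?case using tensor_relations.scale_left[of s' x y "s * c"]
    by (simp add: map_times_diff map_times_single mult.left_commute)
next
  case (scale_right x s' y c)
  then show ?case using tensor_relations.scale_right[of x s' y "s * c"]
    by (simp add: map_times_diff map_times_single mult.left_commute)
qed (simp_all add: map_times_diff map_times_single tensor_relations.add_left tensor_relations.add_right)

lemma tensor_relations_uminus: "p \<in> tensor_relations \<Longrightarrow> - p \<in> tensor_relations"
proof -
  assume "p \<in> tensor_relations"
  then have "Poly_Mapping.map ((*) (-1)) p \<in> tensor_relations" by (rule tensor_relations_scale)
  also have "Poly_Mapping.map ((*) (-1)) p = - p" by (rule poly_mapping_eqI) simp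
  finally show ?thesis .
qed

lemma tensor_relations_minus:
  "p \<in> tensor_relations \<Longrightarrow> q \<in> tensor_relations \<Longrightarrow> p - q \<in> tensor_relations"
  using tensor_relations.plus[OF _ tensor_relations_uminus, of p q] by simp

definition tensor_rel :: "(('a::complex_vector \<times> 'b::complex_vector) \<Rightarrow>\<^sub>0 complex) \<Rightarrow> _ \<Rightarrow> bool" where
  "tensor_rel p q \<longleftrightarrow> p - q \<in> tensor_relations"

lemma equivp_tensor_rel:
  "equivp (tensor_rel :: ('a::complex_vector \<times> 'b::complex_vector \<Rightarrow>\<^sub>0 complex) \<Rightarrow> _)"
proof (rule equivpI)
  show "reflp (tensor_rel :: ('a \<times> 'b \<Rightarrow>\<^sub>0 complex) \<Rightarrow> _)" by (auto intro!: reflpI simp: tensor_rel_def tensor_relations.zero)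
  show "symp (tensor_rel :: ('a \<times> 'b \<Rightarrow>\<^sub>0 complex) \<Rightarrow> _)"
    by (rule sympI) (use tensor_relations_uminus in \<open>fastforce simp: tensor_rel_def\<close>)
  show "transp (tensor_rel :: ('a \<times> 'b \<Rightarrow>\<^sub>0 complex) \<Rightarrow> _)"
  proof (rule transpI)
    fix p q r :: "'a \<times> 'b \<Rightarrow>\<^sub>0 complex"
    assume "tensor_rel p q" "tensor_rel q r"
    then have "(p - q) + (q - r) \<in> tensor_relations"
      unfolding tensor_rel_def by (rule tensor_relations.plus)
    then show "tensor_rel p r" by (simp add: tensor_rel_def)
  qed
qed

quotient_type (overloaded) ('a, 'b) tensor (infixr \<open>\<otimes>\<close> 75) =
  "('a::complex_vector \<times> 'b::complex_vector) \<Rightarrow>\<^sub>0 complex" / tensor_rel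
  by (rule equivp_tensor_rel)

instantiation tensor :: (complex_vector, complex_vector) complex_vector
begin

lift_definition zero_tensor :: "'a \<otimes> 'b" is 0 .

lift_definition plus_tensor :: "'a \<otimes> 'b \<Rightarrow> 'a \<otimes> 'b \<Rightarrow> 'a \<otimes> 'b" is "(+)"
  unfolding tensor_rel_def add_diff_add by (rule tensor_relations.plus)

lift_definition uminus_tensor :: "'a \<otimes> 'b \<Rightarrow> 'a \<otimes> 'b" is uminus
  unfolding tensor_rel_def minus_diff_minus by (rule tensor_relations_uminus)

lift_definition minus_tensor :: "'a \<otimes> 'b \<Rightarrow> 'a \<otimes> 'b \<Rightarrow> 'a \<otimes> 'b" is "(-)"
proof -
  fix p p' q q' :: "('a \<times> 'b) \<Rightarrow>\<^sub>0 complex"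
  assume "tensor_rel p p'" "tensor_rel q q'"
  then have "(p - p') - (q - q') \<in> tensor_relations"
    unfolding tensor_rel_def by (rule tensor_relations_minus)
  also have "(p - p') - (q - q') = (p - q) - (p' - q')" by (simp add: algebra_simps)
  finally show "tensor_rel (p - q) (p' - q')" by (simp add: tensor_rel_def)
qed

lift_definition scaleC_tensor :: "complex \<Rightarrow> 'a \<otimes> 'b \<Rightarrow> 'a \<otimes> 'b"
  is "\<lambda>s. Poly_Mapping.map ((*) s)"
  unfolding tensor_rel_def map_times_diff[symmetric] by (rule tensor_relations_scale)

instance
proof
  fix a b c :: "'a \<otimes> 'b" and s t :: complex
  note refl = equivp_reflp[OF equivp_tensor_rel]
  show "a + b + c = a + (b + c)" by transfer (simp add: add.assoc refl)
  show "a + b = b + a" by transfer (simp add: add.commute refl)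
  show "0 + a = a" by transfer (simp add: refl)
  show "- a + a = 0" by transfer (simp add: refl)
  show "a - b = a + - b" by transfer (simp add: refl)
  show "s *\<^sub>C (a + b) = s *\<^sub>C a + s *\<^sub>C b" by transfer (simp add: map_times_add refl)
  show "(s + t) *\<^sub>C a = s *\<^sub>C a + t *\<^sub>C a"
  proof transfer
    fix s t :: complex and p :: "('a \<times> 'b) \<Rightarrow>\<^sub>0 complex"
    have "Poly_Mapping.map ((*) (s + t)) p = Poly_Mapping.map ((*) s) p + Poly_Mapping.map ((*) t) p"
      by (rule poly_mapping_eqI) (simp add: lookup_add algebra_simps)
    then show "tensor_rel (Poly_Mapping.map ((*) (s + t)) p)
        (Poly_Mapping.map ((*) s) p + Poly_Mapping.map ((*) t) p)" by (simp add: refl)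
  qed
  show "s *\<^sub>C t *\<^sub>C a = (s * t) *\<^sub>C a"
  proof transfer
    fix s t :: complex and p :: "('a \<times> 'b) \<Rightarrow>\<^sub>0 complex"
    have "Poly_Mapping.map ((*) s) (Poly_Mapping.map ((*) t) p) = Poly_Mapping.map ((*) (s * t)) p"
      by (rule poly_mapping_eqI) (simp add: mult.assoc)
    then show "tensor_rel (Poly_Mapping.map ((*) s) (Poly_Mapping.map ((*) t) p))
        (Poly_Mapping.map ((*) (s * t)) p)" by (simp add: refl)
  qed
  show "1 *\<^sub>C a = a"
  proof transfer
    fix p :: "('a \<times> 'b) \<Rightarrow>\<^sub>0 complex"
    have "Poly_Mapping.map ((*) 1) p = p" by (rule poly_mapping_eqI) simp
    then show "tensor_rel (Poly_Mapping.map ((*) 1) p) p" by (simp add: refl)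
  qed
qed

end

lift_definition tensor_pair :: "'a::complex_vector \<Rightarrow> 'b::complex_vector \<Rightarrow> 'a \<otimes> 'b"
    (infixr \<open>\<otimes>\<close> 75)
  is "\<lambda>x y. Poly_Mapping.single (x, y) 1" .

lemma tensor_add_left: "(x + x') \<otimes> y = x \<otimes> y + x' \<otimes> y"
  by transfer (simp add: tensor_rel_def tensor_relations.add_left flip: diff_diff_eq)

lemma tensor_add_right: "x \<otimes> (y + y') = x \<otimes> y + x \<otimes> y'"
  by transfer (simp add: tensor_rel_def tensor_relations.add_right flip: diff_diff_eq)

lemma tensor_scale_left: "(s *\<^sub>C x) \<otimes> y = s *\<^sub>C (x \<otimes> y)"
  by transfer (use tensor_relations.scale_left[where c = 1] in
      \<open>simp add: map_times_single tensor_rel_def\<close>)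

lemma tensor_scale_right: "x \<otimes> (s *\<^sub>C y) = s *\<^sub>C (x \<otimes> y)"
  by transfer (use tensor_relations.scale_right[where c = 1] in
      \<open>simp add: map_times_single tensor_rel_def\<close>)

lemma bilinear_on_tensor_pair: "bilinear_on V W (\<otimes>)"
  by (simp add: bilinear_on_def linear_on_def tensor_add_left tensor_add_right
      tensor_scale_left tensor_scale_right)

abbreviation pure_sum :: "('a::complex_vector \<times> 'b::complex_vector) list \<Rightarrow> 'a \<otimes> 'b" where
  "pure_sum xs \<equiv> (\<Sum>(x, y)\<leftarrow>xs. x \<otimes> y)"

text \<open>For subspaces \<open>V\<close>, \<open>W\<close> this is the image of \<open>V \<otimes> W\<close> in the ambient tensor product.\<close>

definition tensor_space :: "'a::complex_vector set \<Rightarrow> 'b::complex_vector set \<Rightarrow> ('a \<otimes> 'b) set" where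
  "tensor_space V W = {pure_sum xs | xs. set xs \<subseteq> V \<times> W}"

text \<open>The linear map on \<open>V \<otimes> W\<close> induced by a map \<open>f\<close> that is bilinear on \<open>V \<times> W\<close>. In Sweedler
  notation, with \<open>t = t\<^sub>1 \<otimes> t\<^sub>2\<close>, the term \<open>tensor_lift (\<lambda>x y. f x y) t\<close> is \<open>f t\<^sub>1 t\<^sub>2\<close>.\<close>

definition tensor_lift_on :: "'a::complex_vector set \<Rightarrow> 'b::complex_vector set \<Rightarrow>
    ('a \<Rightarrow> 'b \<Rightarrow> 'c::complex_vector) \<Rightarrow> 'a \<otimes> 'b \<Rightarrow> 'c" where
  "tensor_lift_on V W f t =
     (THE z. \<exists>xs. set xs \<subseteq> V \<times> W \<and> t = pure_sum xs \<and> z = (\<Sum>(x, y)\<leftarrow>xs. f x y))"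

abbreviation tensor_lift ::
  "('a::complex_vector \<Rightarrow> 'b::complex_vector \<Rightarrow> 'c::complex_vector) \<Rightarrow> 'a \<otimes> 'b \<Rightarrow> 'c" where
  "tensor_lift \<equiv> tensor_lift_on UNIV UNIV"

text \<open>Well-definedness of \<^const>\<open>tensor_lift_on\<close>.\<close>

definition free_lift :: "('a \<Rightarrow> 'b \<Rightarrow> 'c::complex_vector) \<Rightarrow> (('a \<times> 'b) \<Rightarrow>\<^sub>0 complex) \<Rightarrow> 'c" where
  "free_lift f p = (\<Sum>k\<in>Poly_Mapping.keys p. Poly_Mapping.lookup p k *\<^sub>C f (fst k) (snd k))"

lemma free_lift_superset:
  assumes "finite K" "Poly_Mapping.keys p \<subseteq> K"
  shows "free_lift f p = (\<Sum>k\<in>K. Poly_Mapping.lookup p k *\<^sub>C f (fst k) (snd k))"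
  unfolding free_lift_def using assms
  by (intro sum.mono_neutral_left) (auto simp: in_keys_iff)

lemma free_lift_add: "free_lift f (p + q) = free_lift f p + free_lift f q"
proof -
  let ?K = "Poly_Mapping.keys p \<union> Poly_Mapping.keys q"
  have "free_lift f (p + q) =
      (\<Sum>k\<in>?K. Poly_Mapping.lookup (p + q) k *\<^sub>C f (fst k) (snd k))"
    by (intro free_lift_superset) (auto simp: in_keys_iff lookup_add)
  also have "\<dots> = (\<Sum>k\<in>?K. Poly_Mapping.lookup p k *\<^sub>C f (fst k) (snd k)) +
      (\<Sum>k\<in>?K. Poly_Mapping.lookup q k *\<^sub>C f (fst k) (snd k))"
    by (simp add: lookup_add scaleC_add_left sum.distrib)
  also have "\<dots> = free_lift f p + free_lift f q"
    by (simp flip: free_lift_superset)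
  finally show ?thesis .
qed

lemma free_lift_zero [simp]: "free_lift f 0 = 0"
  by (simp add: free_lift_def)

lemma free_lift_diff: "free_lift f (p - q) = free_lift f p - free_lift f q"
  using free_lift_add[of f "p - q" q] by (simp add: algebra_simps)

lemma free_lift_single: "free_lift f (Poly_Mapping.single (x, y) c) = c *\<^sub>C f x y"
  by (cases "c = 0") (simp_all add: free_lift_def)

lemma free_lift_relations:
  assumes "bilinear_on UNIV UNIV f" "p \<in> tensor_relations"
  shows "free_lift f p = 0"
  using assms(2)
proof (induction rule: tensor_relations.induct)
  case (scale_left s x y c)
  with assms(1) show ?case
    by (simp add: free_lift_diff free_lift_single bilinear_on_def linear_on_def scaleC_scaleC mult.commute)
next
  case (scale_right x s y c)
  with assms(1) show ?case
    by (simp add: free_lift_diff free_lift_single bilinear_on_def linear_on_def scaleC_scaleC mult.commute)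
qed (use assms(1) in \<open>simp_all add: free_lift_add free_lift_diff free_lift_single bilinear_on_def
      linear_on_def scaleC_add_right\<close>)

lemma pure_sum_eqD_UNIV:
  assumes f: "bilinear_on UNIV UNIV f" and eq: "pure_sum xs = pure_sum ys"
  shows "(\<Sum>(x, y)\<leftarrow>xs. f x y) = (\<Sum>(x, y)\<leftarrow>ys. f x y)"
proof -
  define P where "P xs = (\<Sum>(x, y)\<leftarrow>xs. Poly_Mapping.single (x, y) (1::complex))"
    for xs :: "('a \<times> 'b) list"
  have P: "pure_sum xs = abs_tensor (P xs)" for xs :: "('a \<times> 'b) list"
  proof (induction xs)
    case Nil
    then show ?case by (simp add: P_def zero_tensor_def)
  next
    case (Cons z xs)
    then show ?case by (cases z) (simp add: P_def tensor_pair.abs_eq plus_tensor.abs_eq)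
  qed
  have fl: "free_lift f (P xs) = (\<Sum>(x, y)\<leftarrow>xs. f x y)" for xs
    by (induction xs) (auto simp: P_def free_lift_add free_lift_single scaleC_one)
  have "P xs - P ys \<in> tensor_relations"
    using eq by (simp add: P tensor.abs_eq_iff tensor_rel_def)
  from free_lift_relations[OF f this] show ?thesis
    by (simp add: free_lift_diff fl)
qed

lemma projection_onto_subspace:
  fixes V :: "'a::complex_vector set"
  assumes "complex_vector.subspace V"
  obtains p where "linear_on UNIV p" "\<And>x. p x \<in> V" "\<And>x. x \<in> V \<Longrightarrow> p x = x"
proof -
  interpret vector_space_pair "scaleC :: complex \<Rightarrow> 'a \<Rightarrow> 'a" "scaleC :: complex \<Rightarrow> 'a \<Rightarrow> 'a" ..
  have "Vector_Spaces.linear scaleC scaleC (id :: 'a \<Rightarrow> 'a)"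
    by (simp add: complex_vector.linear_id)
  from linear_exists_left_inverse_on[OF this assms] obtain p where
    p: "p ` UNIV \<subseteq> V" "Vector_Spaces.linear scaleC scaleC p" "\<forall>v\<in>V. p (id v) = v"
    by auto
  have "linear_on UNIV p"
    using linear_add[OF p(2)] linear_scale[OF p(2)] by (simp add: linear_on_def)
  then show thesis by (rule that[of p]) (use p in auto)
qed

lemma bilinear_on_extend:
  assumes "complex_vector.subspace V" "complex_vector.subspace W" "bilinear_on V W f"
  obtains g where "bilinear_on UNIV UNIV g" "\<And>x y. x \<in> V \<Longrightarrow> y \<in> W \<Longrightarrow> g x y = f x y"
proof -
  obtain p where p: "linear_on UNIV p" "\<And>x. p x \<in> V" "\<And>x. x \<in> V \<Longrightarrow> p x = x"
    using projection_onto_subspace[OF assms(1)] by blast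
  obtain q where q: "linear_on UNIV q" "\<And>x. q x \<in> W" "\<And>x. x \<in> W \<Longrightarrow> q x = x"
    using projection_onto_subspace[OF assms(2)] by blast
  have "bilinear_on UNIV UNIV (\<lambda>x y. f (p x) (q y))"
    using p(1,2) q(1,2) assms(3) by (simp add: bilinear_on_def linear_on_def)
  with p(3) q(3) that show thesis by simp
qed

lemma tensor_lift_on_pure_sum:
  assumes "complex_vector.subspace V" "complex_vector.subspace W" "bilinear_on V W f"
    and xs: "set xs \<subseteq> V \<times> W"
  shows "tensor_lift_on V W f (pure_sum xs) = (\<Sum>(x, y)\<leftarrow>xs. f x y)"
proof -
  obtain g where g: "bilinear_on UNIV UNIV g" "\<And>x y. x \<in> V \<Longrightarrow> y \<in> W \<Longrightarrow> g x y = f x y"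
    using bilinear_on_extend[OF assms(1-3)] by blast
  have eq: "(\<Sum>(x, y)\<leftarrow>zs. g x y) = (\<Sum>(x, y)\<leftarrow>zs. f x y)" if "set zs \<subseteq> V \<times> W" for zs
    using that by (intro arg_cong[where f = sum_list] map_cong) (auto simp: g(2))
  show ?thesis
    unfolding tensor_lift_on_def
  proof (rule the_equality)
    show "\<exists>ys. set ys \<subseteq> V \<times> W \<and> pure_sum xs = pure_sum ys \<and>
        (\<Sum>(x, y)\<leftarrow>xs. f x y) = (\<Sum>(x, y)\<leftarrow>ys. f x y)"
      using xs by blast
  next
    fix z
    assume "\<exists>ys. set ys \<subseteq> V \<times> W \<and> pure_sum xs = pure_sum ys \<and> z = (\<Sum>(x, y)\<leftarrow>ys. f x y)"
    then show "z = (\<Sum>(x, y)\<leftarrow>xs. f x y)"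
      using pure_sum_eqD_UNIV[OF g(1)] eq xs by metis
  qed
qed

lemma tensor_lift_on_pair:
  assumes "complex_vector.subspace V" "complex_vector.subspace W" "bilinear_on V W f" "x \<in> V" "y \<in> W"
  shows "tensor_lift_on V W f (x \<otimes> y) = f x y"
  using tensor_lift_on_pure_sum[OF assms(1-3), of "[(x, y)]"] assms(4,5) by simp

definition tensor_map_on :: "'a::complex_vector set \<Rightarrow> 'b::complex_vector set \<Rightarrow>
    ('a \<Rightarrow> 'c::complex_vector) \<Rightarrow> ('b \<Rightarrow> 'd::complex_vector) \<Rightarrow> 'a \<otimes> 'b \<Rightarrow> 'c \<otimes> 'd" where
  "tensor_map_on V W f g = tensor_lift_on V W (\<lambda>x y. f x \<otimes> g y)"

abbreviation tensor_map ::
  "('a::complex_vector \<Rightarrow> 'c::complex_vector) \<Rightarrow> ('b::complex_vector \<Rightarrow> 'd::complex_vector) \<Rightarrow>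
    'a \<otimes> 'b \<Rightarrow> 'c \<otimes> 'd" where
  "tensor_map \<equiv> tensor_map_on UNIV UNIV"

definition tensor_assoc ::
  "('a::complex_vector \<otimes> 'b::complex_vector) \<otimes> 'c::complex_vector \<Rightarrow> 'a \<otimes> 'b \<otimes> 'c" where
  "tensor_assoc = tensor_lift (\<lambda>t z. tensor_lift (\<lambda>x y. x \<otimes> y \<otimes> z) t)"

text \<open>The componentwise product \<open>(x \<otimes> y)(x' \<otimes> y') = m x x' \<otimes> n y y'\<close>.\<close>

definition tensor_times_on :: "'a::complex_vector set \<Rightarrow> 'b::complex_vector set \<Rightarrow>
    ('a \<Rightarrow> 'a \<Rightarrow> 'a) \<Rightarrow> ('b \<Rightarrow> 'b \<Rightarrow> 'b) \<Rightarrow> 'a \<otimes> 'b \<Rightarrow> 'a \<otimes> 'b \<Rightarrow> 'a \<otimes> 'b" where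
  "tensor_times_on V W m n s t =
     tensor_lift_on V W (\<lambda>x y. tensor_lift_on V W (\<lambda>x' y'. m x x' \<otimes> n y y') t) s"

abbreviation tensor_times :: "('a::complex_vector \<Rightarrow> 'a \<Rightarrow> 'a) \<Rightarrow> ('b::complex_vector \<Rightarrow> 'b \<Rightarrow> 'b) \<Rightarrow>
    'a \<otimes> 'b \<Rightarrow> 'a \<otimes> 'b \<Rightarrow> 'a \<otimes> 'b" where
  "tensor_times \<equiv> tensor_times_on UNIV UNIV"


section \<open>Algebras, bialgebras and Hopf algebras\<close>

text \<open>The underlying vector space is a subspace \<open>V\<close> of a type; the structure maps
  are only meaningful on \<open>V\<close> (and on \<^term>\<open>tensor_space V V\<close>).\<close>

record ('v::complex_vector) algebra =
  mult :: "'v \<Rightarrow> 'v \<Rightarrow> 'v"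
  unit :: 'v

record (overloaded) ('v::complex_vector) bialgebra = "'v algebra" +
  comult :: "'v \<Rightarrow> 'v \<otimes> 'v"
  counit :: "'v \<Rightarrow> complex"

definition algebra_on :: "'v::complex_vector set \<Rightarrow> ('v, 'z) algebra_scheme \<Rightarrow> bool" where
  "algebra_on V B \<longleftrightarrow>
     complex_vector.subspace V \<and> bilinear_on V V (mult B) \<and>
     (\<forall>x\<in>V. \<forall>y\<in>V. mult B x y \<in> V) \<and> unit B \<in> V \<and>
     (\<forall>x\<in>V. \<forall>y\<in>V. \<forall>z\<in>V. mult B (mult B x y) z = mult B x (mult B y z)) \<and>
     (\<forall>x\<in>V. mult B (unit B) x = x \<and> mult B x (unit B) = x)"

definition coalgebra_on :: "'v::complex_vector set \<Rightarrow> ('v, 'z) bialgebra_scheme \<Rightarrow> bool" where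
  "coalgebra_on V B \<longleftrightarrow>
     complex_vector.subspace V \<and> linear_on V (comult B) \<and> linear_on V (counit B) \<and>
     (\<forall>x\<in>V. comult B x \<in> tensor_space V V) \<and>
     (\<forall>x\<in>V. tensor_assoc (tensor_map_on V V (comult B) id (comult B x)) =
             tensor_map_on V V id (comult B) (comult B x)) \<and>
     (\<forall>x\<in>V. tensor_lift_on V V (\<lambda>y z. counit B y *\<^sub>C z) (comult B x) = x \<and>
             tensor_lift_on V V (\<lambda>y z. counit B z *\<^sub>C y) (comult B x) = x)"

definition bialgebra_on :: "'v::complex_vector set \<Rightarrow> ('v, 'z) bialgebra_scheme \<Rightarrow> bool" where
  "bialgebra_on V B \<longleftrightarrow>
     algebra_on V B \<and> coalgebra_on V B \<and>
     (\<forall>x\<in>V. \<forall>y\<in>V. comult B (mult B x y) =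
        tensor_times_on V V (mult B) (mult B) (comult B x) (comult B y)) \<and>
     comult B (unit B) = unit B \<otimes> unit B \<and>
     (\<forall>x\<in>V. \<forall>y\<in>V. counit B (mult B x y) = counit B x * counit B y) \<and>
     counit B (unit B) = 1"

definition hopf_algebra_on ::
  "'v::complex_vector set \<Rightarrow> ('v, 'z) bialgebra_scheme \<Rightarrow> ('v \<Rightarrow> 'v) \<Rightarrow> bool" where
  "hopf_algebra_on V B S \<longleftrightarrow>
     bialgebra_on V B \<and> linear_on V S \<and> (\<forall>x\<in>V. S x \<in> V) \<and>
     (\<forall>x\<in>V. tensor_lift_on V V (\<lambda>y z. mult B (S y) z) (comult B x) = counit B x *\<^sub>C unit B \<and>
             tensor_lift_on V V (\<lambda>y z. mult B y (S z)) (comult B x) = counit B x *\<^sub>C unit B)"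

abbreviation hopf_algebra :: "('v::complex_vector, 'z) bialgebra_scheme \<Rightarrow> ('v \<Rightarrow> 'v) \<Rightarrow> bool" where
  "hopf_algebra \<equiv> hopf_algebra_on UNIV"

definition hopf_isomorphism_on ::
  "'v::complex_vector set \<Rightarrow> ('v, 'z) bialgebra_scheme \<Rightarrow> ('v \<Rightarrow> 'v) \<Rightarrow>
   'w::complex_vector set \<Rightarrow> ('w, 'y) bialgebra_scheme \<Rightarrow> ('w \<Rightarrow> 'w) \<Rightarrow> ('v \<Rightarrow> 'w) \<Rightarrow> bool" where
  "hopf_isomorphism_on V B S W C T f \<longleftrightarrow>
     linear_on V f \<and> bij_betw f V W \<and>
     (\<forall>x\<in>V. \<forall>y\<in>V. f (mult B x y) = mult C (f x) (f y)) \<and> f (unit B) = unit C \<and>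
     (\<forall>x\<in>V. comult C (f x) = tensor_map_on V V f f (comult B x)) \<and>
     (\<forall>x\<in>V. counit C (f x) = counit B x) \<and>
     (\<forall>x\<in>V. f (S x) = T (f x))"

text \<open>The antipode of a bialgebra is unique if it exists, so quantifying over \<open>S\<close> and \<open>T\<close>
  involves no choice.\<close>

definition hopf_isomorphic_on ::
  "'v::complex_vector set \<Rightarrow> ('v, 'z) bialgebra_scheme \<Rightarrow>
   'w::complex_vector set \<Rightarrow> ('w, 'y) bialgebra_scheme \<Rightarrow> bool" where
  "hopf_isomorphic_on V B W C \<longleftrightarrow>
     (\<exists>S T f. hopf_algebra_on V B S \<and> hopf_algebra_on W C T \<and> hopf_isomorphism_on V B S W C T f)"


section \<open>Convolution\<close>

definition convolution :: "('c::complex_vector \<Rightarrow> 'c \<otimes> 'c) \<Rightarrow> ('b \<Rightarrow> 'b \<Rightarrow> 'b) \<Rightarrow>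
    ('c \<Rightarrow> 'b) \<Rightarrow> ('c \<Rightarrow> 'b) \<Rightarrow> 'c \<Rightarrow> 'b::complex_vector" where
  "convolution \<Delta> m f g x = tensor_lift (\<lambda>y z. m (f y) (g z)) (\<Delta> x)"

definition is_convolution_inverse :: "('c::complex_vector \<Rightarrow> 'c \<otimes> 'c) \<Rightarrow> ('c \<Rightarrow> complex) \<Rightarrow>
    ('b \<Rightarrow> 'b \<Rightarrow> 'b) \<Rightarrow> 'b \<Rightarrow> ('c \<Rightarrow> 'b) \<Rightarrow> ('c \<Rightarrow> 'b::complex_vector) \<Rightarrow> bool" where
  "is_convolution_inverse \<Delta> \<epsilon> m u f g \<longleftrightarrow>
     linear_on UNIV g \<and>
     (\<forall>x. convolution \<Delta> m f g x = \<epsilon> x *\<^sub>C u \<and> convolution \<Delta> m g f x = \<epsilon> x *\<^sub>C u)"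


section \<open>Comodule algebras and Galois objects\<close>

record (overloaded) ('a::complex_vector, 'h::complex_vector) comodule_algebra = "'a algebra" +
  coact :: "'a \<Rightarrow> 'a \<otimes> 'h"

definition is_comodule_algebra ::
  "('h::complex_vector, 'z) bialgebra_scheme \<Rightarrow> ('a::complex_vector, 'h, 'y) comodule_algebra_scheme \<Rightarrow> bool" where
  "is_comodule_algebra H A \<longleftrightarrow>
     algebra_on UNIV A \<and> linear_on UNIV (coact A) \<and>
     (\<forall>a. tensor_assoc (tensor_map (coact A) id (coact A a)) = tensor_map id (comult H) (coact A a)) \<and>
     (\<forall>a. tensor_lift (\<lambda>x h. counit H h *\<^sub>C x) (coact A a) = a) \<and>
     (\<forall>a b. coact A (mult A a b) = tensor_times (mult A) (mult H) (coact A a) (coact A b)) \<and>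
     coact A (unit A) = unit A \<otimes> unit H"

definition coinvariants ::
  "('h::complex_vector, 'z) bialgebra_scheme \<Rightarrow> ('a::complex_vector, 'h, 'y) comodule_algebra_scheme \<Rightarrow> 'a set" where
  "coinvariants H A = {a. coact A a = a \<otimes> unit H}"

definition canonical_map ::
  "('a::complex_vector, 'h::complex_vector, 'y) comodule_algebra_scheme \<Rightarrow> 'a \<otimes> 'a \<Rightarrow> 'a \<otimes> 'h" where
  "canonical_map A = tensor_lift (\<lambda>a a'. tensor_lift (\<lambda>x h. mult A a x \<otimes> h) (coact A a'))"

text \<open>The condition on the coinvariants says that \<open>c \<mapsto> c 1\<^sub>A\<close> identifies the complex numbers
  with them; injectivity excludes the zero algebra.\<close>

definition galois_object ::
  "('h::complex_vector, 'z) bialgebra_scheme \<Rightarrow> ('a::complex_vector, 'h, 'y) comodule_algebra_scheme \<Rightarrow> bool" where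
  "galois_object H A \<longleftrightarrow>
     is_comodule_algebra H A \<and>
     bij_betw (\<lambda>c. c *\<^sub>C unit A) UNIV (coinvariants H A) \<and>
     bij (canonical_map A)"

definition cleft ::
  "('h::complex_vector, 'z) bialgebra_scheme \<Rightarrow> ('a::complex_vector, 'h, 'y) comodule_algebra_scheme \<Rightarrow> bool" where
  "cleft H A \<longleftrightarrow>
     (\<exists>j. linear_on UNIV j \<and>
        (\<forall>h. coact A (j h) = tensor_map j id (comult H h)) \<and>
        (\<exists>j'. is_convolution_inverse (comult H) (counit H) (mult A) (unit A) j j'))"

definition translation_map ::
  "('a::complex_vector, 'h::complex_vector, 'y) comodule_algebra_scheme \<Rightarrow> 'h \<Rightarrow> 'a \<otimes> 'a" where
  "translation_map A h = inv (canonical_map A) (unit A \<otimes> h)"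


section \<open>The Ehresmann-Schauenburg bialgebra of a Galois object\<close>

text \<open>The two sides are \<open>a\<^sub>0 \<otimes> \<tau>(a\<^sub>1) b\<close> and \<open>a \<otimes> b \<otimes> 1\<close> in \<open>A \<otimes> A \<otimes> A\<close>, for \<open>t = a \<otimes> b\<close>, where
  \<open>b\<close> multiplies the second leg of \<open>\<tau>(a\<^sub>1)\<close> from the right.\<close>

definition ES_space :: "('a::complex_vector, 'h::complex_vector, 'y) comodule_algebra_scheme \<Rightarrow> ('a \<otimes> 'a) set" where
  "ES_space A = {t.
     tensor_lift (\<lambda>a b. tensor_lift (\<lambda>a0 a1.
        tensor_lift (\<lambda>p q. a0 \<otimes> p \<otimes> mult A q b) (translation_map A a1)) (coact A a)) t =
     tensor_lift (\<lambda>a b. a \<otimes> b \<otimes> unit A) t}"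

text \<open>The counit is \<open>a \<otimes> b \<mapsto> a b\<close>, a multiple of \<open>1\<^sub>A\<close> on \<^const>\<open>ES_space\<close>.\<close>

definition ES_bialgebra ::
  "('a::complex_vector, 'h::complex_vector, 'y) comodule_algebra_scheme \<Rightarrow> ('a \<otimes> 'a) bialgebra" where
  "ES_bialgebra A = \<lparr>
     mult = tensor_times (mult A) (\<lambda>b b'. mult A b' b),
     unit = unit A \<otimes> unit A,
     comult = tensor_lift (\<lambda>a b. tensor_lift (\<lambda>a0 a1.
        tensor_lift (\<lambda>p q. (a0 \<otimes> p) \<otimes> (q \<otimes> b)) (translation_map A a1)) (coact A a)),
     counit = (\<lambda>t. THE c. tensor_lift (mult A) t = c *\<^sub>C unit A) \<rparr>"


section \<open>Cocycles and twisted Hopf algebras\<close>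

text \<open>The coalgebra \<open>H \<otimes> H\<close>: \<open>\<Delta>(h \<otimes> k) = (h\<^sub>1 \<otimes> k\<^sub>1) \<otimes> (h\<^sub>2 \<otimes> k\<^sub>2)\<close> and \<open>\<epsilon>(h \<otimes> k) = \<epsilon>(h) \<epsilon>(k)\<close>.\<close>

definition comult2 :: "('h::complex_vector, 'z) bialgebra_scheme \<Rightarrow> 'h \<otimes> 'h \<Rightarrow> ('h \<otimes> 'h) \<otimes> ('h \<otimes> 'h)" where
  "comult2 H = tensor_lift (\<lambda>h k. tensor_lift (\<lambda>h1 h2.
     tensor_lift (\<lambda>k1 k2. (h1 \<otimes> k1) \<otimes> (h2 \<otimes> k2)) (comult H k)) (comult H h))"

definition counit2 :: "('h::complex_vector, 'z) bialgebra_scheme \<Rightarrow> 'h \<otimes> 'h \<Rightarrow> complex" where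
  "counit2 H = tensor_lift (\<lambda>h k. counit H h * counit H k)"

abbreviation is_inverse_form :: "('h::complex_vector, 'z) bialgebra_scheme \<Rightarrow>
    ('h \<otimes> 'h \<Rightarrow> complex) \<Rightarrow> ('h \<otimes> 'h \<Rightarrow> complex) \<Rightarrow> bool" where
  "is_inverse_form H \<equiv> is_convolution_inverse (comult2 H) (counit2 H) (*) 1"

definition inverse_form ::
  "('h::complex_vector, 'z) bialgebra_scheme \<Rightarrow> ('h \<otimes> 'h \<Rightarrow> complex) \<Rightarrow> 'h \<otimes> 'h \<Rightarrow> complex" where
  "inverse_form H \<gamma> = (THE \<gamma>'. is_inverse_form H \<gamma> \<gamma>')"

definition invertible_normalised_2_cocycle ::
  "('h::complex_vector, 'z) bialgebra_scheme \<Rightarrow> ('h \<otimes> 'h \<Rightarrow> complex) \<Rightarrow> bool" where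
  "invertible_normalised_2_cocycle H \<gamma> \<longleftrightarrow>
     linear_on UNIV \<gamma> \<and> (\<exists>\<gamma>'. is_inverse_form H \<gamma> \<gamma>') \<and>
     (\<forall>h k m.
        tensor_lift (\<lambda>k1 k2. tensor_lift (\<lambda>m1 m2.
          \<gamma> (k1 \<otimes> m1) * \<gamma> (h \<otimes> mult H k2 m2)) (comult H m)) (comult H k) =
        tensor_lift (\<lambda>h1 h2. tensor_lift (\<lambda>k1 k2.
          \<gamma> (h1 \<otimes> k1) * \<gamma> (mult H h2 k2 \<otimes> m)) (comult H k)) (comult H h)) \<and>
     (\<forall>h. \<gamma> (unit H \<otimes> h) = counit H h \<and> \<gamma> (h \<otimes> unit H) = counit H h)"

text \<open>The product \<open>\<gamma>(h\<^sub>1, g\<^sub>1) h\<^sub>2 g\<^sub>2 \<gamma>\<inverse>(h\<^sub>3, g\<^sub>3)\<close>, with threefold coproducts read as \<open>(id \<otimes> \<Delta>)\<Delta>\<close>.\<close>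

definition twisted_times :: "('h::complex_vector, 'z) bialgebra_scheme \<Rightarrow> ('h \<otimes> 'h \<Rightarrow> complex) \<Rightarrow>
    'h \<Rightarrow> 'h \<Rightarrow> 'h" where
  "twisted_times H \<gamma> h g =
     tensor_lift (\<lambda>h1 h'. tensor_lift (\<lambda>h2 h3. tensor_lift (\<lambda>g1 g'. tensor_lift (\<lambda>g2 g3.
       (\<gamma> (h1 \<otimes> g1) * inverse_form H \<gamma> (h3 \<otimes> g3)) *\<^sub>C mult H h2 g2)
       (comult H g')) (comult H g)) (comult H h')) (comult H h)"

definition twist :: "('h::complex_vector, 'z) bialgebra_scheme \<Rightarrow> ('h \<otimes> 'h \<Rightarrow> complex) \<Rightarrow>
    ('h, 'z) bialgebra_scheme" where
  "twist H \<gamma> = H\<lparr>mult := twisted_times H \<gamma>\<rparr>"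

end

theory Submission
  imports Defs
begin

text \<open>
  Let \<open>j\<close> be the cleaving map, normalised to \<open>j(1) = 1\<close>, with convolution inverse \<open>j'\<close>, and let \<open>\<phi>\<close> be a
  functional on \<open>A\<close> with \<open>\<phi>(1) = 1\<close>. The translation map is \<open>\<tau>(h) = j'(h\<^sub>1) \<otimes> j(h\<^sub>2)\<close>, so injectivity of
  the canonical map gives \<open>1 \<otimes> a = a\<^sub>0 j'(a\<^sub>1) \<otimes> j(a\<^sub>2)\<close>. Hence \<open>a = \<lambda>(a\<^sub>0) j(a\<^sub>1)\<close> for the functional
  \<open>\<lambda>(a) = \<phi>(a\<^sub>0 j'(a\<^sub>1))\<close>, and in particular \<open>j(h) j(g) = \<gamma>(h\<^sub>1, g\<^sub>1) j(h\<^sub>2 g\<^sub>2)\<close> with \<open>\<gamma>(h, g) = \<lambda>(j(h) j(g))\<close>.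
  Evaluating \<open>\<lambda>\<close> on \<open>j(h) j(k) j(m)\<close> in two ways is the cocycle identity. The map
  \<open>h \<mapsto> j(h\<^sub>1) \<otimes> j'(h\<^sub>2)\<close> is a linear bijection of \<open>H\<close> onto the coinvariants of \<open>A \<otimes> A\<close> that turns the twisted
  product into that of \<open>A \<otimes> A\<^sup>o\<^sup>p\<close>; since it is injective, associativity and the antipode identities
  of \<open>H\<^sup>\<gamma>\<close> can be verified in \<open>A \<otimes> A\<^sup>o\<^sup>p\<close>, with antipode \<open>h \<mapsto> \<gamma>(h\<^sub>1, S h\<^sub>2) S(h\<^sub>3) \<gamma>\<inverse>(S h\<^sub>4, h\<^sub>5)\<close>.
\<close>

section \<open>Sweedler sums\<close>

abbreviation lin :: "('a::complex_vector \<Rightarrow> 'b::complex_vector) \<Rightarrow> bool" where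
  "lin \<equiv> linear_on UNIV"

lemma linI: "(\<And>x y. f (x + y) = f x + f y) \<Longrightarrow> (\<And>c x. f (c *\<^sub>C x) = c *\<^sub>C f x) \<Longrightarrow> lin f"
  by (simp add: linear_on_def)

lemma lin_add: "lin f \<Longrightarrow> f (x + y) = f x + f y"
  and lin_scale: "lin f \<Longrightarrow> f (c *\<^sub>C x) = c *\<^sub>C f x"
  by (simp_all add: linear_on_def)

lemma lin_zero: "lin f \<Longrightarrow> f 0 = 0"
  using lin_add[of f 0 0] by simp

lemma lin_sum_list: "lin f \<Longrightarrow> f (\<Sum>x\<leftarrow>xs. g x) = (\<Sum>x\<leftarrow>xs. f (g x))"
  by (induction xs) (simp_all add: lin_add lin_zero)

lemma scaleC_sum_list: "c *\<^sub>C (\<Sum>x\<leftarrow>xs. g x) = (\<Sum>x\<leftarrow>xs. c *\<^sub>C g x)"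
  by (induction xs) (simp_all add: scaleC_add_right)

lemma lin_comp: "lin f \<Longrightarrow> lin g \<Longrightarrow> lin (\<lambda>x. f (g x))"
  by (simp add: linear_on_def)

section \<open>Closure rules for linearity\<close>

named_theorems lin_simps

text \<open>The rules carry an arbitrary linear subterm, so rewriting with \<open>lin_simps\<close>
  peels a Sweedler expression down to its variable.\<close>

lemma lin_basic [lin_simps]:
  "lin (\<lambda>x. x)"
  "lin f \<Longrightarrow> lin (\<lambda>x. c *\<^sub>C f x)"
  "lin s \<Longrightarrow> lin (\<lambda>x. s x *\<^sub>C v)"
  "lin s \<Longrightarrow> lin (\<lambda>x. s x * d)"
  "lin s \<Longrightarrow> lin (\<lambda>x. d * s x)"
  for d :: complex
  by (simp_all add: linear_on_def scaleC_add_left scaleC_add_right scaleC_scaleC algebra_simps)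

lemma lin_id [lin_simps]: "lin id"
  by (simp add: linear_on_def)

lemma lin_tensor [lin_simps]:
  "lin f \<Longrightarrow> lin (\<lambda>x. f x \<otimes> y)" "lin f \<Longrightarrow> lin (\<lambda>x. y \<otimes> f x)"
  by (simp_all add: linear_on_def tensor_add_left tensor_add_right tensor_scale_left tensor_scale_right)

lemma bilinear_UNIV [lin_simps]:
  "bilinear_on UNIV UNIV F \<longleftrightarrow> (\<forall>x. lin (F x)) \<and> (\<forall>y. lin (\<lambda>x. F x y))"
  by (simp add: bilinear_on_def)

abbreviation "bilin \<equiv> bilinear_on UNIV UNIV"

text \<open>Induction on the support of \<open>p\<close>: each new key contributes one pure tensor,
  and its coefficient is absorbed into the left factor.\<close>

lemma abs_tensor_eq_pure_sum: "\<exists>xs. abs_tensor p = pure_sum xs"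
  for p :: "'a::complex_vector \<times> 'b::complex_vector \<Rightarrow>\<^sub>0 complex"
proof (induction p rule: update_induct)
  case const
  show ?case by (rule exI[of _ "[]"]) (simp add: zero_tensor_def)
next
  case (update f k c)
  then obtain xs where xs: "abs_tensor f = pure_sum xs" by blast
  obtain x y where k: "k = (x, y)" by (cases k)
  have "Poly_Mapping.update k c f = f + Poly_Mapping.map ((*) c) (Poly_Mapping.single k 1)"
    using update(1) by (intro poly_mapping_eqI)
      (auto simp: lookup_update lookup_add lookup_single when_def in_keys_iff)
  then have "abs_tensor (Poly_Mapping.update k c f) = abs_tensor f + c *\<^sub>C (x \<otimes> y)"
    by (simp add: k tensor_pair.abs_eq scaleC_tensor.abs_eq plus_tensor.abs_eq)
  then show ?case
    by (intro exI[of _ "(c *\<^sub>C x, y) # xs"]) (simp add: xs tensor_scale_left add.commute)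
qed

lemma tensor_eq_pure_sum: "\<exists>xs. t = pure_sum xs"
  using abs_tensor_eq_pure_sum[of "rep_tensor t"] Quotient3_abs_rep[OF Quotient3_tensor, of t] by simp

definition tensor_rep :: "'a::complex_vector \<otimes> 'b::complex_vector \<Rightarrow> ('a \<times> 'b) list" where
  "tensor_rep t = (SOME xs. t = pure_sum xs)"

lemma pure_sum_tensor_rep: "pure_sum (tensor_rep t) = t"
  unfolding tensor_rep_def by (rule sym, rule someI_ex, rule tensor_eq_pure_sum)

text \<open>In Sweedler notation, \<open>tsum (\<Delta> x) F\<close> is \<open>F x\<^sub>1 x\<^sub>2\<close>. Summing over a fixed representation of the tensor,
  rather than using \<^const>\<open>tensor_lift_on\<close>, makes the sum commute with linear maps and with other such sums
  for arbitrary \<open>F\<close>; bilinearity only matters for the independence of the representation.\<close>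

definition tsum :: "'a::complex_vector \<otimes> 'b::complex_vector \<Rightarrow> ('a \<Rightarrow> 'b \<Rightarrow> 'c::complex_vector) \<Rightarrow> 'c" where
  "tsum t F = (\<Sum>(x, y)\<leftarrow>tensor_rep t. F x y)"

lemma tsum_pure_sum: "bilin F \<Longrightarrow> tsum (pure_sum xs) F = (\<Sum>(x, y)\<leftarrow>xs. F x y)"
  unfolding tsum_def by (rule pure_sum_eqD_UNIV) (simp_all add: pure_sum_tensor_rep)

lemma tsum_tensor: "tsum t (\<otimes>) = t"
  by (simp add: tsum_def pure_sum_tensor_rep)

lemma tensor_lift_tsum: "bilin F \<Longrightarrow> tensor_lift F t = tsum t F"
  using tensor_lift_on_pure_sum[of UNIV UNIV F "tensor_rep t"]
  by (simp add: pure_sum_tensor_rep tsum_def)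

lemma tsum_pair: "bilin F \<Longrightarrow> tsum (x \<otimes> y) F = F x y"
  using tsum_pure_sum[of F "[(x, y)]"] by simp

text \<open>Concatenating representations of \<open>s\<close> and \<open>t\<close> represents
  \<open>s + t\<close>, and scaling the left factors represents a multiple; by
  \<open>tsum_pure_sum\<close> any representation may be used.\<close>

lemma lin_tsum_bilin:
  assumes "bilin F"
  shows "lin (\<lambda>t. tsum t F)"
proof (rule linI)
  fix s t and c
  have "tsum (s + t) F = tsum (pure_sum (tensor_rep s @ tensor_rep t)) F"
    by (simp add: pure_sum_tensor_rep)
  also have "\<dots> = tsum s F + tsum t F"
    by (subst tsum_pure_sum[OF assms]) (simp add: tsum_def)
  finally show "tsum (s + t) F = tsum s F + tsum t F" .
  let ?xs = "map (\<lambda>(x, y). (c *\<^sub>C x, y)) (tensor_rep t)"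
  have "pure_sum ?xs = c *\<^sub>C pure_sum (tensor_rep t)"
    by (simp add: scaleC_sum_list case_prod_unfold comp_def tensor_scale_left)
  then have "tsum (c *\<^sub>C t) F = tsum (pure_sum ?xs) F"
    by (simp add: pure_sum_tensor_rep)
  also have "\<dots> = c *\<^sub>C tsum t F"
    unfolding tsum_pure_sum[OF assms] unfolding tsum_def using assms
    by (simp add: scaleC_sum_list case_prod_unfold comp_def bilinear_on_def linear_on_def)
  finally show "tsum (c *\<^sub>C t) F = c *\<^sub>C tsum t F" .
qed

lemma lin_tsum [lin_simps]:
  "bilin F \<Longrightarrow> lin T \<Longrightarrow> lin (\<lambda>x. tsum (T x) F)"
  "\<forall>a b. lin (\<lambda>x. G x a b) \<Longrightarrow> lin (\<lambda>x. tsum t (\<lambda>a b. G x a b))"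
  subgoal by (rule lin_comp[OF lin_tsum_bilin])
  subgoal
    unfolding tsum_def
    by (rule linI) (simp_all add: linear_on_def case_prod_unfold scaleC_sum_list sum_list_addf)
  done

lemma lin_tsum_out: "lin L \<Longrightarrow> L (tsum t F) = tsum t (\<lambda>x y. L (F x y))"
  by (simp add: tsum_def lin_sum_list case_prod_unfold)

lemma tsum_tsum: "bilin F \<Longrightarrow> tsum (tsum t G) F = tsum t (\<lambda>x y. tsum (G x y) F)"
  by (rule lin_tsum_out[OF lin_tsum_bilin])

lemma sum_list_commute:
  "(\<Sum>x\<leftarrow>xs. \<Sum>y\<leftarrow>ys. G x y) = (\<Sum>y\<leftarrow>ys. \<Sum>x\<leftarrow>xs. G x y)"
  for G :: "_ \<Rightarrow> _ \<Rightarrow> 'a::comm_monoid_add"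
  by (induction xs) (simp_all add: sum_list_addf)

lemma tsum_commute:
  "tsum s (\<lambda>a b. tsum t (\<lambda>c d. F a b c d)) = tsum t (\<lambda>c d. tsum s (\<lambda>a b. F a b c d))"
  unfolding tsum_def case_prod_unfold by (rule sum_list_commute)

lemma tsum_out:
  "c *\<^sub>C tsum t F = tsum t (\<lambda>x y. c *\<^sub>C F x y)"
  "tsum t f *\<^sub>C v = tsum t (\<lambda>x y. f x y *\<^sub>C v)"
  "d * tsum t f = tsum t (\<lambda>x y. d * f x y)"
  "tsum t f * d = tsum t (\<lambda>x y. f x y * d)"
  "w \<otimes> tsum t F = tsum t (\<lambda>x y. w \<otimes> F x y)"
  "tsum t F \<otimes> w = tsum t (\<lambda>x y. F x y \<otimes> w)"
  for d :: complex
  by (rule lin_tsum_out[where L = "\<lambda>x. c *\<^sub>C x"], simp add: lin_simps)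
    (rule lin_tsum_out[where L = "\<lambda>x. x *\<^sub>C v"] lin_tsum_out[where L = "\<lambda>x. d * x"]
      lin_tsum_out[where L = "\<lambda>x. x * d"] lin_tsum_out[where L = "\<lambda>x. w \<otimes> x"]
      lin_tsum_out[where L = "\<lambda>x. x \<otimes> w"], simp add: lin_simps)+

lemma tensor_ext:
  assumes "lin f" "lin g" "\<And>x y. f (x \<otimes> y) = g (x \<otimes> y)"
  shows "f t = g t"
proof -
  have "f (tsum t (\<otimes>)) = g (tsum t (\<otimes>))"
    by (simp add: lin_tsum_out assms)
  then show ?thesis by (simp add: tsum_tensor)
qed

lemma tensor_map_tsum: "lin f \<Longrightarrow> lin g \<Longrightarrow> tensor_map f g t = tsum t (\<lambda>x y. f x \<otimes> g y)"
  unfolding tensor_map_on_def by (rule tensor_lift_tsum) (simp add: lin_simps)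

lemma tensor_assoc_tsum: "tensor_assoc t = tsum t (\<lambda>s z. tsum s (\<lambda>x y. x \<otimes> y \<otimes> z))"
  by (simp add: tensor_assoc_def tensor_lift_tsum lin_simps)

section \<open>Coalgebras, algebras and convolution\<close>

locale coalg =
  fixes \<Delta> :: "'c::complex_vector \<Rightarrow> 'c \<otimes> 'c" and \<epsilon> :: "'c \<Rightarrow> complex"
  assumes lin_comult: "lin \<Delta>" and lin_counit: "lin \<epsilon>"
    and coassoc_tensor: "tsum (\<Delta> x) (\<lambda>a b. tsum (\<Delta> a) (\<lambda>c d. c \<otimes> d \<otimes> b)) =
      tsum (\<Delta> x) (\<lambda>a b. tsum (\<Delta> b) (\<lambda>c d. a \<otimes> c \<otimes> d))"
    and counit_left_id: "tsum (\<Delta> x) (\<lambda>a b. \<epsilon> a *\<^sub>C b) = x"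
    and counit_right_id: "tsum (\<Delta> x) (\<lambda>a b. \<epsilon> b *\<^sub>C a) = x"
begin

lemma lin_coalg [lin_simps]:
  "lin \<Delta>" "lin \<epsilon>" "lin f \<Longrightarrow> lin (\<lambda>x. \<Delta> (f x))" "lin f \<Longrightarrow> lin (\<lambda>x. \<epsilon> (f x))"
  by (simp_all add: lin_comult lin_counit lin_comp[OF lin_comult] lin_comp[OF lin_counit])

text \<open>A trilinear \<open>F\<close> induces the linear map \<open>?L\<close> on the triple
  tensor product. Applying it to \<open>coassoc_tensor\<close> lets legs be regrouped inside any
  trilinear expression.\<close>

lemma coassoc:
  assumes "\<forall>a b. lin (\<lambda>x. F x a b)" "\<forall>a b. lin (\<lambda>x. F a x b)" "\<forall>a b. lin (\<lambda>x. F a b x)"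
  shows "tsum (\<Delta> x) (\<lambda>a b. tsum (\<Delta> a) (\<lambda>c d. F c d b)) =
    tsum (\<Delta> x) (\<lambda>a b. tsum (\<Delta> b) (\<lambda>c d. F a c d))"
proof -
  let ?L = "\<lambda>t. tsum t (\<lambda>a s. tsum s (\<lambda>c d. F a c d))"
  have L: "lin ?L" "\<And>a c d. ?L (a \<otimes> c \<otimes> d) = F a c d"
    using assms by (simp_all add: lin_simps tsum_pair)
  show ?thesis
    using arg_cong[OF coassoc_tensor[of x], of ?L]
    by (simp only: lin_tsum_out[OF L(1)] L(2))
qed

lemma counit_left: "lin F \<Longrightarrow> tsum (\<Delta> x) (\<lambda>a b. \<epsilon> a *\<^sub>C F b) = F x"
  using lin_tsum_out[of F "\<Delta> x" "\<lambda>a b. \<epsilon> a *\<^sub>C b"] by (simp add: counit_left_id lin_scale)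

lemma counit_right: "lin F \<Longrightarrow> tsum (\<Delta> x) (\<lambda>a b. \<epsilon> b *\<^sub>C F a) = F x"
  using lin_tsum_out[of F "\<Delta> x" "\<lambda>a b. \<epsilon> b *\<^sub>C a"] by (simp add: counit_right_id lin_scale)

end

lemma coalgebra_on_UNIV: "coalgebra_on UNIV B \<Longrightarrow> coalg (comult B) (counit B)"
proof -
  assume B: "coalgebra_on UNIV B"
  then have l: "lin (comult B)" "lin (counit B)"
    by (simp_all add: coalgebra_on_def)
  have l': "lin f \<Longrightarrow> lin (\<lambda>x. comult B (f x))" "lin f \<Longrightarrow> lin (\<lambda>x. counit B (f x))" for f :: "_ \<Rightarrow> 'a"
    by (auto intro: lin_comp l)
  note B = B[unfolded coalgebra_on_def, simplified, THEN conjunct2, THEN conjunct2, THEN conjunct2]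
  show ?thesis
  proof
    fix x
    show "tsum (comult B x) (\<lambda>a b. tsum (comult B a) (\<lambda>c d. c \<otimes> d \<otimes> b)) =
        tsum (comult B x) (\<lambda>a b. tsum (comult B b) (\<lambda>c d. a \<otimes> c \<otimes> d))"
      using B[THEN conjunct1, rule_format, of x]
      by (simp add: tensor_map_tsum tensor_assoc_tsum l lin_simps tsum_tsum tsum_pair
            flip: lin_tsum_out[of "\<lambda>x. a \<otimes> x" for a] add: tsum_tensor)
    show "tsum (comult B x) (\<lambda>a b. counit B a *\<^sub>C b) = x" "tsum (comult B x) (\<lambda>a b. counit B b *\<^sub>C a) = x"
      using B[THEN conjunct2, rule_format, of x] by (simp_all add: tensor_lift_tsum lin_simps l l')
  qed (use l in auto)
qed

locale alg =
  fixes m :: "'b \<Rightarrow> 'b \<Rightarrow> 'b::complex_vector" and u :: 'b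
  assumes lin_mult_left: "lin (\<lambda>x. m x y)" and lin_mult_right: "lin (m x)"
    and mult_assoc: "m (m x y) z = m x (m y z)"
    and unit_left: "m u x = x" and unit_right: "m x u = x"
begin

lemma lin_alg [lin_simps]:
  "lin f \<Longrightarrow> lin (\<lambda>x. m (f x) y)" "lin f \<Longrightarrow> lin (\<lambda>x. m y (f x))" "lin (m x)"
  by (simp_all add: lin_mult_right lin_comp[OF lin_mult_left] lin_comp[OF lin_mult_right])

lemma mult_tsum:
  "m (tsum t F) y = tsum t (\<lambda>a b. m (F a b) y)" "m y (tsum t F) = tsum t (\<lambda>a b. m y (F a b))"
  by (rule lin_tsum_out[OF lin_mult_left] lin_tsum_out[OF lin_mult_right])+

lemma mult_scale: "m (c *\<^sub>C x) y = c *\<^sub>C m x y" "m y (c *\<^sub>C x) = c *\<^sub>C m y x"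
  by (rule lin_scale[OF lin_mult_left] lin_scale[OF lin_mult_right])+

lemma alg_op: "alg (\<lambda>x y. m y x) u"
  by standard (simp_all add: mult_assoc unit_left unit_right lin_simps)

end

lemma algebra_on_UNIV: "algebra_on UNIV B \<Longrightarrow> alg (mult B) (unit B)"
  by standard (simp_all add: algebra_on_def lin_simps)

lemma alg_complex: "alg (*) (1::complex)"
  by standard (simp_all add: lin_simps)

lemma tensor_times_tsum:
  assumes "bilin m" "bilin n"
  shows "tensor_times m n s t = tsum s (\<lambda>x y. tsum t (\<lambda>x' y'. m x x' \<otimes> n y y'))"
proof -
  have "lin (\<lambda>x. m (f x) y)" "lin (\<lambda>x. m y (f x))" if "lin f" for f :: "'a \<Rightarrow> 'a" and y
    using assms that by (auto simp: linear_on_def bilinear_on_def)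
  moreover have "lin (\<lambda>x. n (f x) y)" "lin (\<lambda>x. n y (f x))" if "lin f" for f :: "'b \<Rightarrow> 'b" and y
    using assms that by (auto simp: linear_on_def bilinear_on_def)
  ultimately show ?thesis
    by (simp add: tensor_times_on_def tensor_lift_tsum lin_simps)
qed

lemma tensor_times_pair:
  assumes "alg m u" "alg n v"
  shows "tensor_times m n (x \<otimes> y) (x' \<otimes> y') = m x x' \<otimes> n y y'"
proof -
  interpret A: alg m u by fact
  interpret B: alg n v by fact
  show ?thesis
    by (simp add: tensor_times_tsum tsum_pair lin_simps)
qed

lemma alg_tensor:
  assumes "alg m u" "alg n v"
  shows "alg (tensor_times m n) (u \<otimes> v)"
proof -
  interpret A: alg m u by fact
  interpret B: alg n v by fact
  have tt: "tensor_times m n s t = tsum s (\<lambda>x y. tsum t (\<lambda>x' y'. m x x' \<otimes> n y y'))" for s t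
    by (simp add: tensor_times_tsum lin_simps)
  show ?thesis
  proof
    fix s t r
    show "lin (\<lambda>x. tensor_times m n x t)" "lin (tensor_times m n s)"
      unfolding tt[abs_def] by (simp_all add: lin_simps)
    show "tensor_times m n (tensor_times m n s t) r = tensor_times m n s (tensor_times m n t r)"
      by (simp add: tt lin_simps tsum_tsum tsum_pair A.mult_assoc B.mult_assoc)
    show "tensor_times m n (u \<otimes> v) s = s" "tensor_times m n s (u \<otimes> v) = s"
      by (simp_all add: tt tsum_pair lin_simps A.unit_left A.unit_right B.unit_left B.unit_right tsum_tensor)
  qed
qed

section \<open>Convolution algebras\<close>

definition conv_prod :: "('c::complex_vector \<Rightarrow> 'c \<otimes> 'c) \<Rightarrow> ('b \<Rightarrow> 'b \<Rightarrow> 'b) \<Rightarrow> ('c \<Rightarrow> 'b) \<Rightarrow> ('c \<Rightarrow> 'b) \<Rightarrow>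
    'c \<Rightarrow> 'b::complex_vector" where
  "conv_prod \<Delta> m F G x = tsum (\<Delta> x) (\<lambda>y z. m (F y) (G z))"

locale conv = C: coalg \<Delta> \<epsilon> + B: alg m u
  for \<Delta> :: "'c::complex_vector \<Rightarrow> 'c \<otimes> 'c" and \<epsilon> and m :: "'b \<Rightarrow> 'b \<Rightarrow> 'b::complex_vector" and u
begin

abbreviation star (infixl \<open>\<star>\<close> 70) where "F \<star> G \<equiv> conv_prod \<Delta> m F G"

text \<open>Embeds scalar-valued forms into the algebra-valued maps as multiples of the unit. By
  \<open>conv_prod_scal\<close> this respects convolution, so forms and maps can be multiplied
  together.\<close>

abbreviation scal :: "('c \<Rightarrow> complex) \<Rightarrow> 'c \<Rightarrow> 'b" where "scal s \<equiv> (\<lambda>x. s x *\<^sub>C u)"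

abbreviation one (\<open>\<one>\<close>) where "\<one> \<equiv> scal \<epsilon>"

lemma lin_conv_prod [lin_simps]: "lin F \<Longrightarrow> lin G \<Longrightarrow> lin (F \<star> G)"
  unfolding conv_prod_def by (simp add: lin_simps)

lemma conv_prod_assoc: "lin F \<Longrightarrow> lin G \<Longrightarrow> lin K \<Longrightarrow> F \<star> G \<star> K = F \<star> (G \<star> K)"
  unfolding conv_prod_def
  by (rule ext) (simp add: lin_simps B.mult_tsum C.coassoc B.mult_assoc)

lemma conv_prod_scal_left: "(scal s \<star> F) x = tsum (\<Delta> x) (\<lambda>y z. s y *\<^sub>C F z)"
  and conv_prod_scal_right: "(F \<star> scal s) x = tsum (\<Delta> x) (\<lambda>y z. s z *\<^sub>C F y)"
  by (simp_all add: conv_prod_def B.mult_scale B.unit_left B.unit_right)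

lemma conv_prod_one_left: "lin F \<Longrightarrow> \<one> \<star> F = F"
  and conv_prod_one_right: "lin F \<Longrightarrow> F \<star> \<one> = F"
  by (simp_all add: fun_eq_iff conv_prod_scal_left conv_prod_scal_right C.counit_left C.counit_right)

lemma conv_prod_cancel_left:
  "F \<star> G = \<one> \<Longrightarrow> lin F \<Longrightarrow> lin G \<Longrightarrow> lin K \<Longrightarrow> F \<star> (G \<star> K) = K"
  by (simp add: conv_prod_one_left flip: conv_prod_assoc)

lemma conv_prod_inverse_unique:
  assumes "G \<star> F = \<one>" "F \<star> G' = \<one>" "lin F" "lin G" "lin G'"
  shows "G = G'"
proof -
  have "G = G \<star> (F \<star> G')" by (simp only: assms(2) conv_prod_one_right assms(4))
  also have "\<dots> = G'" by (rule conv_prod_cancel_left[OF assms(1) assms(4,3,5)])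
  finally show ?thesis .
qed

lemma conv_prod_scal: "scal s \<star> scal t = scal (conv_prod \<Delta> (*) s t)"
  by (rule ext, subst conv_prod_scal_left) (simp add: conv_prod_def tsum_out scaleC_scaleC)

lemma scal_inverse: "conv_prod \<Delta> (*) s t = \<epsilon> \<Longrightarrow> scal s \<star> scal t = \<one>"
  by (simp add: conv_prod_scal)

end

section \<open>Hopf algebras\<close>

locale hopf =
  fixes H :: "('h::complex_vector, 'z) bialgebra_scheme" and S :: "'h \<Rightarrow> 'h"
  assumes hopf: "hopf_algebra H S"
begin

lemma bialgebra: "bialgebra_on UNIV H"
  using hopf by (simp add: hopf_algebra_on_def)

sublocale C: coalg "comult H" "counit H"
  using bialgebra by (intro coalgebra_on_UNIV) (simp add: bialgebra_on_def)

sublocale M: alg "mult H" "unit H"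
  using bialgebra by (intro algebra_on_UNIV) (simp add: bialgebra_on_def)

sublocale MM: alg "tensor_times (mult H) (mult H)" "unit H \<otimes> unit H"
  by (rule alg_tensor) unfold_locales

sublocale HH: conv "comult H" "counit H" "tensor_times (mult H) (mult H)" "unit H \<otimes> unit H" ..

abbreviation dot (infixl \<open>\<cdot>\<close> 78) where "x \<cdot> y \<equiv> mult H x y"

lemma comult_times: "comult H (x \<cdot> y) = tensor_times (mult H) (mult H) (comult H x) (comult H y)"
  using bialgebra by (simp add: bialgebra_on_def)

lemma comult_mult:
  "comult H (x \<cdot> y) = tsum (comult H x) (\<lambda>a b. tsum (comult H y) (\<lambda>c d. a \<cdot> c \<otimes> b \<cdot> d))"
  by (simp add: comult_times tensor_times_tsum lin_simps)

lemma comult_unit: "comult H (unit H) = unit H \<otimes> unit H"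
  and counit_mult: "counit H (x \<cdot> y) = counit H x * counit H y"
  and counit_unit: "counit H (unit H) = 1"
  using bialgebra by (simp_all add: bialgebra_on_def)

lemma tsum_comult_mult:
  "bilin F \<Longrightarrow> tsum (comult H (x \<cdot> y)) F =
    tsum (comult H x) (\<lambda>a b. tsum (comult H y) (\<lambda>c d. F (a \<cdot> c) (b \<cdot> d)))"
  by (simp add: comult_mult tsum_tsum tsum_pair)

lemma lin_S [lin_simps]: "lin S" "lin f \<Longrightarrow> lin (\<lambda>x. S (f x))"
  using hopf lin_comp[of S f] by (simp_all add: hopf_algebra_on_def)

lemma antipode:
  "tsum (comult H x) (\<lambda>a b. S a \<cdot> b) = counit H x *\<^sub>C unit H"
  "tsum (comult H x) (\<lambda>a b. a \<cdot> S b) = counit H x *\<^sub>C unit H"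
  using hopf by (simp_all add: hopf_algebra_on_def tensor_lift_tsum lin_simps)

lemma tsum_antipode_left: "lin F \<Longrightarrow> tsum (comult H x) (\<lambda>a b. F (S a \<cdot> b)) = counit H x *\<^sub>C F (unit H)"
  using lin_tsum_out[of F "comult H x" "\<lambda>a b. S a \<cdot> b"] by (simp add: antipode lin_scale)

lemma tsum_antipode_right: "lin F \<Longrightarrow> tsum (comult H x) (\<lambda>a b. F (a \<cdot> S b)) = counit H x *\<^sub>C F (unit H)"
  using lin_tsum_out[of F "comult H x" "\<lambda>a b. a \<cdot> S b"] by (simp add: antipode lin_scale)

text \<open>Apply the counit to the antipode identity: by multiplicativity it becomes an instance of
  the counit law.\<close>

lemma counit_S: "counit H (S x) = counit H x"
proof -
  have "counit H x = tsum (comult H x) (\<lambda>a b. counit H b *\<^sub>C counit H (S a))"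
    using tsum_antipode_left[of "counit H" x]
    by (simp add: lin_simps counit_mult counit_unit mult.commute)
  also have "\<dots> = counit H (S x)"
    by (rule C.counit_right) (simp add: lin_simps)
  finally show ?thesis by simp
qed

text \<open>Both sides are convolution inverses of the coproduct among maps from H to H \<otimes> H:
  the left one since the coproduct is multiplicative, the right one by cancelling from the inside
  out.\<close>

lemma comult_S: "comult H (S x) = tsum (comult H x) (\<lambda>a b. S b \<otimes> S a)"
proof -
  let ?R = "\<lambda>x. tsum (comult H x) (\<lambda>a b. S b \<otimes> S a)"
  have "(\<lambda>x. comult H (S x)) = ?R"
  proof (rule HH.conv_prod_inverse_unique[where F = "comult H"])
    show "HH.star (\<lambda>x. comult H (S x)) (comult H) = HH.one"
      by (simp add: conv_prod_def fun_eq_iff comult_unit tsum_antipode_left lin_simps flip: comult_times)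
    have "HH.star (comult H) ?R x = HH.one x" for x
    proof -
      have "HH.star (comult H) ?R x = tsum (comult H x) (\<lambda>y z. tsum (comult H y) (\<lambda>a b.
          tsum (comult H z) (\<lambda>c d. a \<cdot> S d \<otimes> b \<cdot> S c)))"
        by (simp add: conv_prod_def tensor_times_tsum tsum_tsum tsum_pair lin_simps)
      also have "\<dots> = tsum (comult H x) (\<lambda>a y. tsum (comult H y) (\<lambda>b z.
          tsum (comult H z) (\<lambda>c d. a \<cdot> S d \<otimes> b \<cdot> S c)))"
        by (rule C.coassoc) (simp_all add: lin_simps)
      \<comment> \<open>The two middle legs are brought under a common coproduct, so that
        \<open>b \<cdot> S c\<close> cancels first and \<open>a \<cdot> S d\<close>
        afterwards.\<close>
      also have "\<dots> = tsum (comult H x) (\<lambda>a y. tsum (comult H y) (\<lambda>z d.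
          tsum (comult H z) (\<lambda>b c. a \<cdot> S d \<otimes> b \<cdot> S c)))"
        by (subst C.coassoc) (simp_all add: lin_simps)
      also have "\<dots> = tsum (comult H x) (\<lambda>a y. a \<cdot> S y \<otimes> unit H)"
        by (simp add: tsum_antipode_right[where F = "\<lambda>x. w \<otimes> x" for w] C.counit_left lin_simps)
      also have "\<dots> = HH.one x"
        by (simp add: tsum_antipode_right[where F = "\<lambda>x. x \<otimes> w" for w] lin_simps)
      finally show ?thesis .
    qed
    then show "HH.star (comult H) ?R = HH.one" by blast
  qed (simp_all add: lin_simps)
  then show ?thesis by (rule fun_cong)
qed

lemma tsum_comult_S:
  "bilin F \<Longrightarrow> tsum (comult H (S x)) F = tsum (comult H x) (\<lambda>a b. F (S b) (S a))"
  by (simp add: comult_S tsum_tsum tsum_pair)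

section \<open>The tensor product coalgebra H \<otimes> H\<close>

lemma comult2_tsum: "comult2 H t = tsum t (\<lambda>h k. tsum (comult H h) (\<lambda>h1 h2.
     tsum (comult H k) (\<lambda>k1 k2. (h1 \<otimes> k1) \<otimes> (h2 \<otimes> k2))))"
  by (simp add: comult2_def tensor_lift_tsum lin_simps)

lemma counit2_tsum: "counit2 H t = tsum t (\<lambda>h k. counit H h * counit H k)"
  by (simp add: counit2_def tensor_lift_tsum lin_simps)

lemma counit2_pair: "counit2 H (h \<otimes> k) = counit H h * counit H k"
  by (simp add: counit2_tsum tsum_pair lin_simps)

lemma tsum_comult2:
  "bilin F \<Longrightarrow> tsum (comult2 H (h \<otimes> k)) F = tsum (comult H h) (\<lambda>h1 h2.
     tsum (comult H k) (\<lambda>k1 k2. F (h1 \<otimes> k1) (h2 \<otimes> k2)))"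
  by (simp add: comult2_tsum tsum_tsum tsum_pair lin_simps)

text \<open>On pure tensors the sums over the two factors are interchanged until both coproducts of
  each factor are adjacent; coassociativity then applies to each factor separately.\<close>

sublocale C2: coalg "comult2 H" "counit2 H"
proof
  show lins: "lin (comult2 H)" "lin (counit2 H)"
    unfolding comult2_tsum[abs_def] counit2_tsum[abs_def] by (simp_all add: lin_simps)
  have l [lin_simps]: "lin f \<Longrightarrow> lin (\<lambda>x. comult2 H (f x))" "lin f \<Longrightarrow> lin (\<lambda>x. counit2 H (f x))"
    for f :: "'x::complex_vector \<Rightarrow> 'h \<otimes> 'h"
    by (auto intro: lin_comp lins)
  fix t
  show "tsum (comult2 H t) (\<lambda>a b. tsum (comult2 H a) (\<lambda>c d. c \<otimes> d \<otimes> b)) =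
    tsum (comult2 H t) (\<lambda>a b. tsum (comult2 H b) (\<lambda>c d. a \<otimes> c \<otimes> d))"
  proof (rule tensor_ext[where f = "\<lambda>t. tsum (comult2 H t) (\<lambda>a b. tsum (comult2 H a) (\<lambda>c d. c \<otimes> d \<otimes> b))"
        and g = "\<lambda>t. tsum (comult2 H t) (\<lambda>a b. tsum (comult2 H b) (\<lambda>c d. a \<otimes> c \<otimes> d))"])
    fix h k
    have "tsum (comult2 H (h \<otimes> k)) (\<lambda>a b. tsum (comult2 H a) (\<lambda>c d. c \<otimes> d \<otimes> b)) =
      tsum (comult H h) (\<lambda>h1 h2. tsum (comult H k) (\<lambda>k1 k2.
        tsum (comult H h1) (\<lambda>h11 h12. tsum (comult H k1) (\<lambda>k11 k12.
          (h11 \<otimes> k11) \<otimes> (h12 \<otimes> k12) \<otimes> (h2 \<otimes> k2)))))"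
      by (simp add: tsum_comult2 lin_simps)
    also have "\<dots> = tsum (comult H h) (\<lambda>h1 h2. tsum (comult H h1) (\<lambda>h11 h12.
        tsum (comult H k) (\<lambda>k1 k2. tsum (comult H k1) (\<lambda>k11 k12.
          (h11 \<otimes> k11) \<otimes> (h12 \<otimes> k12) \<otimes> (h2 \<otimes> k2)))))"
      by (subst tsum_commute[of "comult H k"]) (rule refl)
    also have "\<dots> = tsum (comult H h) (\<lambda>h1 h2. tsum (comult H h2) (\<lambda>h11 h12.
        tsum (comult H k) (\<lambda>k1 k2. tsum (comult H k2) (\<lambda>k11 k12.
          (h1 \<otimes> k1) \<otimes> (h11 \<otimes> k11) \<otimes> (h12 \<otimes> k12)))))"
      by (simp add: C.coassoc lin_simps)
    also have "\<dots> = tsum (comult H h) (\<lambda>h1 h2. tsum (comult H k) (\<lambda>k1 k2.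
        tsum (comult H h2) (\<lambda>h11 h12. tsum (comult H k2) (\<lambda>k11 k12.
          (h1 \<otimes> k1) \<otimes> (h11 \<otimes> k11) \<otimes> (h12 \<otimes> k12)))))"
      by (subst tsum_commute[of "comult H k"]) (rule refl)
    also have "\<dots> = tsum (comult2 H (h \<otimes> k)) (\<lambda>a b. tsum (comult2 H b) (\<lambda>c d. a \<otimes> c \<otimes> d))"
      by (simp add: tsum_comult2 lin_simps)
    finally show "tsum (comult2 H (h \<otimes> k)) (\<lambda>a b. tsum (comult2 H a) (\<lambda>c d. c \<otimes> d \<otimes> b)) =
      tsum (comult2 H (h \<otimes> k)) (\<lambda>a b. tsum (comult2 H b) (\<lambda>c d. a \<otimes> c \<otimes> d))" .
  qed (simp_all add: lin_simps)
  have split: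
    "(counit H h1 * counit H k1) *\<^sub>C (h2 \<otimes> k2) = (counit H h1 *\<^sub>C h2) \<otimes> (counit H k1 *\<^sub>C k2)" for h1 k1 h2 k2
    by (simp_all add: tensor_scale_left tensor_scale_right scaleC_scaleC)
  show "tsum (comult2 H t) (\<lambda>a b. counit2 H a *\<^sub>C b) = t"
    by (rule tensor_ext[where g = "\<lambda>t. t"]) (simp_all add: tsum_comult2 counit2_pair lin_simps split
        C.counit_left_id flip: tsum_out(5,6))
  show "tsum (comult2 H t) (\<lambda>a b. counit2 H b *\<^sub>C a) = t"
    by (rule tensor_ext[where g = "\<lambda>t. t"]) (simp_all add: tsum_comult2 counit2_pair lin_simps split
        C.counit_right_id flip: tsum_out(5,6))
qed

end

section \<open>Cleft Galois objects\<close>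

lemma fun_tensor_ext: "lin f \<Longrightarrow> lin g \<Longrightarrow> (\<And>x y. f (x \<otimes> y) = g (x \<otimes> y)) \<Longrightarrow> f = g"
  using tensor_ext[of f g] by blast

locale comodule_alg = hopf H S
  for H :: "('h::complex_vector, 'z) bialgebra_scheme" and S :: "'h \<Rightarrow> 'h" +
  fixes A :: "('a::complex_vector, 'h, 'y) comodule_algebra_scheme"
  assumes comodule_algebra: "is_comodule_algebra H A"
begin

abbreviation adot (infixl \<open>\<bullet>\<close> 78) where "x \<bullet> y \<equiv> mult A x y"

sublocale A: alg "mult A" "unit A"
  using comodule_algebra by (intro algebra_on_UNIV) (simp add: is_comodule_algebra_def)

lemma lin_coact [lin_simps]: "lin (coact A)" "lin f \<Longrightarrow> lin (\<lambda>x. coact A (f x))"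
  using comodule_algebra lin_comp[of "coact A" f] by (simp_all add: is_comodule_algebra_def)

lemma coact_coassoc_tensor:
  "tsum (coact A a) (\<lambda>x h. tsum (coact A x) (\<lambda>y k. y \<otimes> k \<otimes> h)) =
    tsum (coact A a) (\<lambda>x h. tsum (comult H h) (\<lambda>k l. x \<otimes> k \<otimes> l))"
  using comodule_algebra unfolding is_comodule_algebra_def
  by (simp add: tensor_map_tsum tensor_assoc_tsum lin_simps tsum_tsum tsum_pair tsum_tensor
        flip: lin_tsum_out[of "\<lambda>x. a \<otimes> x" for a])

lemma coact_coassoc:
  assumes "\<forall>a b. lin (\<lambda>x. F x a b)" "\<forall>a b. lin (\<lambda>x. F a x b)" "\<forall>a b. lin (\<lambda>x. F a b x)"
  shows "tsum (coact A a) (\<lambda>x h. tsum (coact A x) (\<lambda>y k. F y k h)) =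
    tsum (coact A a) (\<lambda>x h. tsum (comult H h) (\<lambda>k l. F x k l))"
proof -
  let ?L = "\<lambda>t. tsum t (\<lambda>a s. tsum s (\<lambda>c d. F a c d))"
  have L: "lin ?L" "\<And>a c d. ?L (a \<otimes> c \<otimes> d) = F a c d"
    using assms by (simp_all add: lin_simps tsum_pair)
  show ?thesis
    using arg_cong[OF coact_coassoc_tensor[of a], of ?L]
    by (simp only: lin_tsum_out[OF L(1)] L(2))
qed

lemma coact_mult:
  "coact A (a \<bullet> b) = tsum (coact A a) (\<lambda>x h. tsum (coact A b) (\<lambda>y k. x \<bullet> y \<otimes> h \<cdot> k))"
  using comodule_algebra by (simp add: is_comodule_algebra_def tensor_times_tsum lin_simps)

lemma tsum_coact_mult:
  "bilin F \<Longrightarrow> tsum (coact A (a \<bullet> b)) F =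
    tsum (coact A a) (\<lambda>x h. tsum (coact A b) (\<lambda>y k. F (x \<bullet> y) (h \<cdot> k)))"
  by (simp add: coact_mult tsum_tsum tsum_pair)

lemma canonical_map_tsum:
  "canonical_map A t = tsum t (\<lambda>a a'. tsum (coact A a') (\<lambda>x h. a \<bullet> x \<otimes> h))"
  by (simp add: canonical_map_def tensor_lift_tsum lin_simps)

lemma lin_canonical_map [lin_simps]: "lin (canonical_map A)"
  unfolding canonical_map_tsum[abs_def] by (simp add: lin_simps)

section \<open>Convolution algebras on H and H \<otimes> H\<close>

sublocale HA: conv "comult H" "counit H" "mult A" "unit A" ..
sublocale HHA: conv "comult2 H" "counit2 H" "mult A" "unit A" ..
sublocale HHH: conv "comult2 H" "counit2 H" "mult H" "unit H" ..
sublocale HHHH: conv "comult2 H" "counit2 H" "tensor_times (mult H) (mult H)" "unit H \<otimes> unit H" ..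
text \<open>\<open>AO\<close> is the opposite algebra and \<open>E\<close> is A \<otimes> A^op,
  whose product the Ehresmann-Schauenburg bialgebra uses; \<open>HE\<close> and \<open>HHE\<close>
  consist of the maps into it from H and from H \<otimes> H.\<close>

sublocale AO: alg "\<lambda>x y. mult A y x" "unit A"
  by (rule A.alg_op)
sublocale E: alg "tensor_times (mult A) (\<lambda>x y. mult A y x)" "unit A \<otimes> unit A"
  by (rule alg_tensor) unfold_locales
sublocale HE: conv "comult H" "counit H" "tensor_times (mult A) (\<lambda>x y. mult A y x)" "unit A \<otimes> unit A" ..
sublocale HHE: conv "comult2 H" "counit2 H" "tensor_times (mult A) (\<lambda>x y. mult A y x)" "unit A \<otimes> unit A" ..
sublocale Cx: alg "(*)" "1::complex"
  by (rule alg_complex)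
sublocale HC: conv "comult H" "counit H" "(*)" "1::complex" ..
sublocale HHC: conv "comult2 H" "counit2 H" "(*)" "1::complex" ..

end

text \<open>The cleaving map is taken normalised, and \<open>\<phi>\<close> reads off coefficients
  of the unit; \<open>cleft_galoisE\<close> produces such data by rescaling.\<close>

locale cleft_galois = comodule_alg H S A
  for H :: "('h::complex_vector, 'z) bialgebra_scheme" and S :: "'h \<Rightarrow> 'h"
    and A :: "('a::complex_vector, 'h, 'y) comodule_algebra_scheme" +
  fixes j j' :: "'h \<Rightarrow> 'a" and \<phi> :: "'a \<Rightarrow> complex"
  assumes inj_canonical_map: "inj (canonical_map A)"
    and lin_j': "lin j" "lin j'"
    and coact_j: "coact A (j h) = tsum (comult H h) (\<lambda>x y. j x \<otimes> y)"
    and j_unit: "j (unit H) = unit A"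
    and j_inverse: "HA.star j j' = HA.one" "HA.star j' j = HA.one"
    and lin_\<phi>': "lin \<phi>" and \<phi>_unit: "\<phi> (unit A) = 1"
begin

lemma lin_j [lin_simps]:
  "lin j" "lin f \<Longrightarrow> lin (\<lambda>x. j (f x))" "lin j'" "lin f \<Longrightarrow> lin (\<lambda>x. j' (f x))"
  "lin \<phi>" "lin g \<Longrightarrow> lin (\<lambda>x. \<phi> (g x))"
  using lin_j' lin_\<phi>' by (auto intro: lin_comp)

lemma tsum_coact_j: "bilin F \<Longrightarrow> tsum (coact A (j h)) F = tsum (comult H h) (\<lambda>x y. F (j x) y)"
  by (simp add: coact_j tsum_tsum tsum_pair)

lemma j_cancel:
  "tsum (comult H x) (\<lambda>a b. j a \<bullet> j' b) = counit H x *\<^sub>C unit A"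
  "tsum (comult H x) (\<lambda>a b. j' a \<bullet> j b) = counit H x *\<^sub>C unit A"
  using j_inverse by (simp_all add: conv_prod_def fun_eq_iff)

lemma tsum_j_cancel:
  assumes "lin F"
  shows "tsum (comult H x) (\<lambda>a b. F (j a \<bullet> j' b)) = counit H x *\<^sub>C F (unit A)"
    "tsum (comult H x) (\<lambda>a b. F (j' a \<bullet> j b)) = counit H x *\<^sub>C F (unit A)"
  using lin_tsum_out[OF assms, of "comult H x" "\<lambda>a b. j a \<bullet> j' b"]
    lin_tsum_out[OF assms, of "comult H x" "\<lambda>a b. j' a \<bullet> j b"]
  by (simp_all add: j_cancel lin_scale assms)

text \<open>Since \<open>j\<close> is colinear, the image is a j'(h_1) j(h_2) \<otimes> h_3, in
  which j' and j cancel.\<close>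

lemma canonical_map_inverse:
  "canonical_map A (tsum (comult H h) (\<lambda>x y. a \<bullet> j' x \<otimes> j y)) = a \<otimes> h"
proof -
  have "canonical_map A (tsum (comult H h) (\<lambda>x y. a \<bullet> j' x \<otimes> j y)) =
      tsum (comult H h) (\<lambda>x y. tsum (comult H y) (\<lambda>p q. (a \<bullet> j' x) \<bullet> j p \<otimes> q))"
    by (simp add: canonical_map_tsum tsum_tsum tsum_pair tsum_coact_j lin_simps)
  also have "\<dots> = tsum (comult H h) (\<lambda>y q. tsum (comult H y) (\<lambda>x p. (a \<bullet> j' x) \<bullet> j p \<otimes> q))"
    by (rule C.coassoc[symmetric]) (simp_all add: lin_simps)
  also have "\<dots> = tsum (comult H h) (\<lambda>y q. counit H y *\<^sub>C (a \<otimes> q))"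
    by (simp add: A.mult_assoc A.unit_right lin_simps tsum_j_cancel(2)[where F = "\<lambda>w. a \<bullet> w \<otimes> q" for q])
  also have "\<dots> = a \<otimes> h"
    by (rule C.counit_left) (simp add: lin_simps)
  finally show ?thesis .
qed

lemma translation_map_cleft: "translation_map A h = tsum (comult H h) (\<lambda>x y. j' x \<otimes> j y)"
  unfolding translation_map_def
  by (rule inv_f_eq[OF inj_canonical_map])
    (use canonical_map_inverse[of h "unit A"] in \<open>simp add: A.unit_left\<close>)

section \<open>Coordinates on A given by the cleaving map\<close>

definition lam :: "'a \<Rightarrow> complex" where
  "lam a = tsum (coact A a) (\<lambda>x h. \<phi> (x \<bullet> j' h))"

lemma lin_lam [lin_simps]: "lin lam" "lin f \<Longrightarrow> lin (\<lambda>x. lam (f x))"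
  unfolding lam_def by (simp_all add: lin_simps)

text \<open>Both sides have the image \<open>coact A a\<close> under the injective canonical
  map.\<close>

lemma unit_tensor_expand:
  "unit A \<otimes> a = tsum (coact A a) (\<lambda>x h. tsum (comult H h) (\<lambda>p q. x \<bullet> j' p \<otimes> j q))"
proof (rule injD[OF inj_canonical_map])
  have "canonical_map A (unit A \<otimes> a) = coact A a"
    by (simp add: canonical_map_tsum tsum_pair A.unit_left tsum_tensor lin_simps)
  then show "canonical_map A (unit A \<otimes> a) =
      canonical_map A (tsum (coact A a) (\<lambda>x h. tsum (comult H h) (\<lambda>p q. x \<bullet> j' p \<otimes> j q)))"
    by (simp add: lin_tsum_out[OF lin_canonical_map, of "coact A a"] canonical_map_inverse tsum_tensor)
qed

text \<open>Apply \<open>\<phi>\<close> to the first leg of \<open>unit_tensor_expand\<close>;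
  coassociativity of the coaction then collects the coefficient into \<open>lam\<close>.\<close>

lemma expand: "tsum (coact A a) (\<lambda>x h. lam x *\<^sub>C j h) = a"
proof -
  let ?L = "\<lambda>t. tsum t (\<lambda>x y. \<phi> x *\<^sub>C y)"
  have "a = ?L (unit A \<otimes> a)"
    by (simp add: tsum_pair lin_simps \<phi>_unit scaleC_one)
  also have "\<dots> = tsum (coact A a) (\<lambda>x h. tsum (comult H h) (\<lambda>p q. \<phi> (x \<bullet> j' p) *\<^sub>C j q))"
    by (simp add: unit_tensor_expand tsum_tsum tsum_pair lin_simps)
  also have "\<dots> = tsum (coact A a) (\<lambda>x h. tsum (coact A x) (\<lambda>y k. \<phi> (y \<bullet> j' k) *\<^sub>C j h))"
    by (rule coact_coassoc[symmetric]) (simp_all add: lin_simps)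
  also have "\<dots> = tsum (coact A a) (\<lambda>x h. lam x *\<^sub>C j h)"
    by (simp add: lam_def tsum_out)
  finally show ?thesis by simp
qed

text \<open>As \<open>j\<close> is bijective with inverse \<open>j_inv\<close>, this identifies
  \<open>lam\<close> as the counit of H carried over to A along \<open>j\<close>.\<close>

lemma lam_j: "lam (j h) = counit H h"
  by (simp add: lam_def tsum_coact_j lin_simps tsum_j_cancel(1) \<phi>_unit)

definition j_inv :: "'a \<Rightarrow> 'h" where
  "j_inv a = tsum (coact A a) (\<lambda>x h. lam x *\<^sub>C h)"

lemma lin_j_inv [lin_simps]: "lin j_inv" "lin f \<Longrightarrow> lin (\<lambda>x. j_inv (f x))"
  unfolding j_inv_def by (simp_all add: lin_simps)

lemma j_inv_j: "j_inv (j h) = h"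
  by (simp add: j_inv_def tsum_coact_j lin_simps lam_j C.counit_left_id)

lemma j_j_inv: "j (j_inv a) = a"
  by (simp add: j_inv_def lin_tsum_out[OF lin_j(1)] lin_scale[OF lin_j(1)] expand)

section \<open>The cocycle\<close>

definition sig :: "'h \<otimes> 'h \<Rightarrow> complex" where
  "sig t = tsum t (\<lambda>h g. lam (j h \<bullet> j g))"

lemma lin_sig [lin_simps]: "lin sig" "lin f \<Longrightarrow> lin (\<lambda>x. sig (f x))"
  unfolding sig_def by (simp_all add: lin_simps)

lemma sig_pair: "sig (h \<otimes> g) = lam (j h \<bullet> j g)"
  by (simp add: sig_def tsum_pair lin_simps)

text \<open>This is \<open>expand\<close> for the product, whose coaction is known because
  \<open>j\<close> is colinear and the coaction multiplicative. So \<open>sig\<close> measures how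
  far \<open>j\<close> is from being multiplicative.\<close>

lemma j_mult: "j h \<bullet> j g = tsum (comult H h) (\<lambda>h1 h2. tsum (comult H g) (\<lambda>g1 g2.
    sig (h1 \<otimes> g1) *\<^sub>C j (h2 \<cdot> g2)))"
  using expand[of "j h \<bullet> j g"] by (simp add: tsum_coact_mult tsum_coact_j sig_pair lin_simps)

lemma sig_cocycle:
  "tsum (comult H k) (\<lambda>k1 k2. tsum (comult H m) (\<lambda>m1 m2. sig (k1 \<otimes> m1) * sig (h \<otimes> k2 \<cdot> m2))) =
   tsum (comult H h) (\<lambda>h1 h2. tsum (comult H k) (\<lambda>k1 k2. sig (h1 \<otimes> k1) * sig (h2 \<cdot> k2 \<otimes> m)))"
  (is "?l = ?r")
proof -
  have "?l = lam (j h \<bullet> (j k \<bullet> j m))"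
    by (subst j_mult) (simp add: sig_pair A.mult_tsum A.mult_scale lin_tsum_out[OF lin_lam(1)]
        lin_scale[OF lin_lam(1)])
  also have "\<dots> = lam ((j h \<bullet> j k) \<bullet> j m)"
    by (simp add: A.mult_assoc)
  also have "\<dots> = ?r"
    by (subst j_mult) (simp add: sig_pair A.mult_tsum A.mult_scale lin_tsum_out[OF lin_lam(1)]
        lin_scale[OF lin_lam(1)])
  finally show ?thesis .
qed

lemma sig_unit: "sig (unit H \<otimes> h) = counit H h" "sig (h \<otimes> unit H) = counit H h"
  by (simp_all add: sig_pair j_unit A.unit_left A.unit_right lam_j)

section \<open>The convolution inverse of the cocycle\<close>

definition "mult_lin t = tsum t (\<lambda>h g. h \<cdot> g)"
definition "U t = tsum t (\<lambda>h g. j h \<bullet> j g)"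
definition "U' t = tsum t (\<lambda>h g. j' g \<bullet> j' h)"
definition "V t = tsum t (\<lambda>h g. j (h \<cdot> g))"
definition "V' t = tsum t (\<lambda>h g. j' (h \<cdot> g))"

lemmas UV_defs = mult_lin_def U_def U'_def V_def V'_def

lemma lin_UV [lin_simps]: "lin mult_lin" "lin U" "lin U'" "lin V" "lin V'"
  "lin f \<Longrightarrow> lin (\<lambda>x. mult_lin (f x))" "lin f \<Longrightarrow> lin (\<lambda>x. U (f x))" "lin f \<Longrightarrow> lin (\<lambda>x. U' (f x))"
  "lin f \<Longrightarrow> lin (\<lambda>x. V (f x))" "lin f \<Longrightarrow> lin (\<lambda>x. V' (f x))"
  unfolding UV_defs by (simp_all add: lin_simps)

lemma UV_pair: "mult_lin (h \<otimes> g) = h \<cdot> g" "U (h \<otimes> g) = j h \<bullet> j g" "U' (h \<otimes> g) = j' g \<bullet> j' h"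
  "V (h \<otimes> g) = j (h \<cdot> g)" "V' (h \<otimes> g) = j' (h \<cdot> g)"
  by (simp_all add: UV_defs tsum_pair lin_simps)

lemma U_inverse: "HHA.star U U' = HHA.one" "HHA.star U' U = HHA.one"
proof -
  have "HHA.star U U' (h \<otimes> g) = HHA.one (h \<otimes> g)" for h g
  proof -
    have "HHA.star U U' (h \<otimes> g) = tsum (comult H h) (\<lambda>h1 h2. tsum (comult H g) (\<lambda>g1 g2.
        j h1 \<bullet> ((j g1 \<bullet> j' g2) \<bullet> j' h2)))"
      by (simp add: conv_prod_def tsum_comult2 UV_pair A.mult_assoc lin_simps)
    also have "\<dots> = HHA.one (h \<otimes> g)"
      by (simp add: tsum_j_cancel(1)[where F = "\<lambda>w. a \<bullet> (w \<bullet> b)" for a b] lin_simps A.unit_left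
          j_cancel counit2_pair scaleC_scaleC mult.commute flip: tsum_out(1))
    finally show ?thesis .
  qed
  then show "HHA.star U U' = HHA.one" by (intro fun_tensor_ext) (simp_all add: lin_simps)
  have "HHA.star U' U (h \<otimes> g) = HHA.one (h \<otimes> g)" for h g
  proof -
    have "HHA.star U' U (h \<otimes> g) = tsum (comult H h) (\<lambda>h1 h2. tsum (comult H g) (\<lambda>g1 g2.
        j' g1 \<bullet> ((j' h1 \<bullet> j h2) \<bullet> j g2)))"
      by (simp add: conv_prod_def tsum_comult2 UV_pair A.mult_assoc lin_simps)
    also have "\<dots> = HHA.one (h \<otimes> g)"
      \<comment> \<open>The sum over \<open>h\<close> is moved inside, as here \<open>j' h1\<close>
        and \<open>j h2\<close> are adjacent and must cancel first.\<close>
      by (subst tsum_commute) (simp add: tsum_j_cancel(2)[where F = "\<lambda>w. a \<bullet> (w \<bullet> b)" for a b] lin_simps A.unit_left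
          j_cancel counit2_pair scaleC_scaleC mult.commute flip: tsum_out(1))
    finally show ?thesis .
  qed
  then show "HHA.star U' U = HHA.one" by (intro fun_tensor_ext) (simp_all add: lin_simps)
qed

text \<open>Multiplication is a coalgebra map, so composing it with the inverse pair
  \<open>j\<close>, \<open>j'\<close> gives an inverse pair again.\<close>

lemma V_inverse: "HHA.star V V' = HHA.one" "HHA.star V' V = HHA.one"
  by (rule fun_tensor_ext; simp add: conv_prod_def tsum_comult2 UV_pair lin_simps counit2_pair
      tsum_comult_mult[where F = "\<lambda>a b. j a \<bullet> j' b", symmetric]
      tsum_comult_mult[where F = "\<lambda>a b. j' a \<bullet> j b", symmetric] j_cancel counit_mult)+

text \<open>This is \<open>j_mult\<close> in convolution form: \<open>sig\<close> is the quotient of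
  \<open>U\<close> by \<open>V\<close>, so its inverse has to come from \<open>V\<close> convolved
  with \<open>U'\<close>.\<close>

lemma U_eq: "U = HHA.star (HHA.scal sig) V"
  by (rule fun_tensor_ext) (simp_all add: HHA.conv_prod_scal_left tsum_comult2 UV_pair j_mult lin_simps)

definition sig' :: "'h \<otimes> 'h \<Rightarrow> complex" where
  "sig' t = \<phi> (HHA.star V U' t)"

lemma lin_sig' [lin_simps]: "lin sig'" "lin f \<Longrightarrow> lin (\<lambda>x. sig' (f x))"
  unfolding sig'_def by (simp_all add: lin_simps lin_comp[of "HHA.star V U'"])

text \<open>First \<open>V\<close> convolved with \<open>U'\<close> is shown to invert
  \<open>scal sig\<close> among the A-valued maps; applying \<open>\<phi>\<close>, which is 1 at the
  unit, then gives the identities for scalar forms.\<close>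

lemma sig_inverse: "conv_prod (comult2 H) (*) sig sig' = counit2 H" "conv_prod (comult2 H) (*) sig' sig = counit2 H"
proof -
  have 1: "HHA.star (HHA.scal sig) (HHA.star V U') = HHA.one"
    by (simp add: lin_simps flip: HHA.conv_prod_assoc U_eq) (simp add: U_inverse)
  have "HHA.scal sig = HHA.star U V'"
    by (simp add: U_eq HHA.conv_prod_assoc lin_simps V_inverse HHA.conv_prod_one_right)
  then have 2: "HHA.star (HHA.star V U') (HHA.scal sig) = HHA.one"
    by (simp add: HHA.conv_prod_assoc HHA.conv_prod_cancel_left[OF U_inverse(2)] V_inverse lin_simps)
  show "conv_prod (comult2 H) (*) sig sig' = counit2 H"
  proof
    fix t
    show "conv_prod (comult2 H) (*) sig sig' t = counit2 H t"
      using arg_cong[OF fun_cong[OF 1, of t], of \<phi>]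
      by (simp only: HHA.conv_prod_scal_left) (simp add: conv_prod_def[of _ _ sig] sig'_def lin_tsum_out[OF lin_\<phi>'] lin_scale[OF lin_\<phi>'] \<phi>_unit)
  qed
  show "conv_prod (comult2 H) (*) sig' sig = counit2 H"
  proof
    fix t
    show "conv_prod (comult2 H) (*) sig' sig t = counit2 H t"
      using arg_cong[OF fun_cong[OF 2, of t], of \<phi>]
      by (simp only: HHA.conv_prod_scal_right) (simp add: conv_prod_def[of _ _ sig'] sig'_def lin_tsum_out[OF lin_\<phi>'] lin_scale[OF lin_\<phi>'] \<phi>_unit mult.commute)
  qed
qed

lemma U'_eq: "U' = HHA.star V' (HHA.scal sig')"
proof (rule HHA.conv_prod_inverse_unique[OF U_inverse(2)])
  show "HHA.star U (HHA.star V' (HHA.scal sig')) = HHA.one"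
    by (simp add: U_eq HHA.conv_prod_assoc HHA.conv_prod_cancel_left[OF V_inverse(1)]
        HHA.scal_inverse[OF sig_inverse(1)] lin_simps)
qed (simp_all add: lin_simps)

lemma V_eq: "V = HHA.star (HHA.scal sig') U"
  by (simp add: U_eq HHA.conv_prod_cancel_left[OF HHA.scal_inverse[OF sig_inverse(2)]] lin_simps)

text \<open>Uniqueness of convolution inverses; it evaluates the definite description in
  \<open>inverse_form\<close>.\<close>

lemma inverse_form_iff: "is_inverse_form H sig g \<longleftrightarrow> g = sig'"
proof
  assume g: "is_inverse_form H sig g"
  then have "lin g" by (simp add: is_convolution_inverse_def)
  moreover from this g have "conv_prod (comult2 H) (*) g sig = counit2 H"
    by (simp add: fun_eq_iff is_convolution_inverse_def convolution_def conv_prod_def tensor_lift_tsum lin_simps lin_comp[of g])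
  ultimately show "g = sig'"
    using HHC.conv_prod_inverse_unique[of g sig sig'] sig_inverse by (simp add: lin_simps)
next
  assume g: "g = sig'"
  show "is_inverse_form H sig g"
    unfolding g using sig_inverse by (simp add: fun_eq_iff is_convolution_inverse_def convolution_def conv_prod_def tensor_lift_tsum lin_simps)
qed

lemma inverse_form_sig: "inverse_form H sig = sig'"
  by (simp add: inverse_form_def inverse_form_iff)

lemma cocycle: "invertible_normalised_2_cocycle H sig"
  unfolding invertible_normalised_2_cocycle_def inverse_form_iff
  using sig_cocycle by (simp add: lin_simps sig_unit tensor_lift_tsum)

abbreviation edot (infixl \<open>\<odot>\<close> 72) where
  "s \<odot> t \<equiv> tensor_times (mult A) (\<lambda>x y. mult A y x) s t"

lemma edot_pair: "(a \<otimes> b) \<odot> (c \<otimes> d) = a \<bullet> c \<otimes> d \<bullet> b"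
  by (rule tensor_times_pair) unfold_locales

text \<open>The twisted product as a convolution of maps from H \<otimes> H to H, so that the
  factors \<open>sig\<close> and \<open>sig'\<close> can be cancelled algebraically.\<close>

definition twisted :: "'h \<otimes> 'h \<Rightarrow> 'h" where
  "twisted = HHH.star (HHH.scal sig) (HHH.star mult_lin (HHH.scal sig'))"

lemma lin_twisted [lin_simps]: "lin twisted" "lin f \<Longrightarrow> lin (\<lambda>x. twisted (f x))"
  unfolding twisted_def by (simp_all add: lin_simps lin_comp[of "HHH.star F G" for F G])

text \<open>For linear \<open>L\<close> the composite is again \<open>sig\<close> and
  \<open>sig'\<close> convolved around \<open>L \<circ> mult_lin\<close>. It serves for the
  coproduct, the counit and \<open>es_map\<close>.\<close>

lemma lin_twisted_out:
  assumes "lin L"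
  shows "L (twisted t) = tsum (comult2 H t) (\<lambda>x y. tsum (comult2 H y) (\<lambda>y z. (sig x * sig' z) *\<^sub>C L (mult_lin y)))"
  unfolding twisted_def HHH.conv_prod_scal_left HHH.conv_prod_scal_right
  by (simp add: lin_tsum_out[OF assms] lin_scale[OF assms] tsum_out scaleC_scaleC)

text \<open>\<open>twisted_times\<close> splits \<open>h\<close> completely before \<open>g\<close>,
  whereas \<open>comult2\<close> splits both in step; interchanging the two middle sums reconciles
  them.\<close>

lemma twisted_times_eq: "twisted_times H sig h g = twisted (h \<otimes> g)"
proof -
  have "twisted_times H sig h g = tsum (comult H h) (\<lambda>h1 h'. tsum (comult H h') (\<lambda>h2 h3.
      tsum (comult H g) (\<lambda>g1 g'. tsum (comult H g') (\<lambda>g2 g3.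
        (sig (h1 \<otimes> g1) * sig' (h3 \<otimes> g3)) *\<^sub>C (h2 \<cdot> g2)))))"
    by (simp add: twisted_times_def inverse_form_sig tensor_lift_tsum lin_simps)
  also have "\<dots> = tsum (comult H h) (\<lambda>h1 h'. tsum (comult H g) (\<lambda>g1 g'.
      tsum (comult H h') (\<lambda>h2 h3. tsum (comult H g') (\<lambda>g2 g3.
        (sig (h1 \<otimes> g1) * sig' (h3 \<otimes> g3)) *\<^sub>C (h2 \<cdot> g2)))))"
    by (subst tsum_commute[of "comult H g"]) (rule refl)
  also have "\<dots> = twisted (h \<otimes> g)"
    using lin_twisted_out[of "\<lambda>x. x" "h \<otimes> g"] by (simp add: tsum_comult2 UV_pair lin_simps)
  finally show ?thesis .
qed

section \<open>The isomorphism onto the Ehresmann-Schauenburg bialgebra\<close>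

definition es_map :: "'h \<Rightarrow> 'a \<otimes> 'a" where
  "es_map h = tsum (comult H h) (\<lambda>x y. j x \<otimes> j' y)"

lemma lin_es_map [lin_simps]: "lin es_map" "lin g \<Longrightarrow> lin (\<lambda>x. es_map (g x))"
  unfolding es_map_def by (simp_all add: lin_simps)

text \<open>In A \<otimes> A^op the product is j(h_1) j(g_1) \<otimes> j'(g_2) j'(h_2), the
  convolution of \<open>U\<close> in the first leg with \<open>U'\<close> in the second. Taking out
  \<open>sig\<close> on the left and \<open>sig'\<close> on the right leaves \<open>V\<close> and
  \<open>V'\<close>, which together are \<open>es_map\<close> of the untwisted product.\<close>

lemma es_map_twisted: "es_map (twisted (h \<otimes> g)) = es_map h \<odot> es_map g"
proof -
  let ?l = "\<lambda>F t. F t \<otimes> unit A" and ?r = "\<lambda>F t. unit A \<otimes> F t"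
  have "es_map h \<odot> es_map g = HHE.star (?l U) (?r U') (h \<otimes> g)"
  proof -
    have "es_map h \<odot> es_map g = tsum (comult H h) (\<lambda>h1 h2. tsum (comult H g) (\<lambda>g1 g2. j h1 \<bullet> j g1 \<otimes> j' g2 \<bullet> j' h2))"
      by (simp add: es_map_def E.mult_tsum edot_pair, subst tsum_commute, rule refl)
    then show ?thesis
      by (simp add: conv_prod_def tsum_comult2 UV_pair edot_pair A.unit_left A.unit_right lin_simps)
  qed
  also have "?l U = HHE.star (HHE.scal sig) (?l V)"
    by (rule ext, subst U_eq)
      (simp add: HHE.conv_prod_scal_left HHA.conv_prod_scal_left tsum_out tensor_scale_left)
  also have "?r U' = HHE.star (?r V') (HHE.scal sig')"
    by (rule ext, subst U'_eq)
      (simp add: HHE.conv_prod_scal_right HHA.conv_prod_scal_right tsum_out tensor_scale_right)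
  also have "HHE.star (HHE.star (HHE.scal sig) (?l V)) (HHE.star (?r V') (HHE.scal sig')) =
      HHE.star (HHE.scal sig) (HHE.star (HHE.star (?l V) (?r V')) (HHE.scal sig'))"
    by (simp add: HHE.conv_prod_assoc lin_simps)
  also have "HHE.star (?l V) (?r V') = (\<lambda>t. es_map (mult_lin t))"
    by (rule fun_tensor_ext) (simp_all add: conv_prod_def UV_pair es_map_def tsum_comult2 edot_pair
        A.unit_left A.unit_right tsum_comult_mult lin_simps)
  also have "HHE.star (HHE.scal sig) (HHE.star (\<lambda>t. es_map (mult_lin t)) (HHE.scal sig')) (h \<otimes> g) = es_map (twisted (h \<otimes> g))"
    unfolding lin_twisted_out[OF lin_es_map(1)] HHE.conv_prod_scal_left HHE.conv_prod_scal_right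
    by (simp add: tsum_out scaleC_scaleC)
  finally show ?thesis by simp
qed

lemma j'_unit: "j' (unit H) = unit A"
  using j_cancel(1)[of "unit H"]
  by (simp add: comult_unit tsum_pair lin_simps counit_unit scaleC_one j_unit A.unit_left)

lemma es_map_unit: "es_map (unit H) = unit A \<otimes> unit A"
  by (simp add: es_map_def comult_unit tsum_pair lin_simps j_unit j'_unit)

text \<open>For a = j(h) the value is h_1 \<phi>(j(h_2) b). The factor j(h_2) is there to cancel the
  j' contributed by the second leg of \<open>es_map\<close>.\<close>

definition es_inv :: "'a \<otimes> 'a \<Rightarrow> 'h" where
  "es_inv t = tsum t (\<lambda>a b. tsum (comult H (j_inv a)) (\<lambda>x y. \<phi> (j y \<bullet> b) *\<^sub>C x))"

lemma es_inv_es_map: "es_inv (es_map h) = h"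
proof -
  have "es_inv (es_map h) = tsum (comult H h) (\<lambda>x z. tsum (comult H x) (\<lambda>x y. \<phi> (j y \<bullet> j' z) *\<^sub>C x))"
    by (simp add: es_inv_def es_map_def tsum_tsum tsum_pair j_inv_j lin_simps)
  also have "\<dots> = tsum (comult H h) (\<lambda>x z. tsum (comult H z) (\<lambda>y z. \<phi> (j y \<bullet> j' z) *\<^sub>C x))"
    by (rule C.coassoc) (simp_all add: lin_simps)
  also have "\<dots> = h"
    by (simp add: tsum_j_cancel(1)[where F = "\<lambda>w. \<phi> w *\<^sub>C x" for x] \<phi>_unit scaleC_one C.counit_right_id lin_simps)
  finally show ?thesis .
qed

lemma inj_es_map: "inj es_map"
  by (rule inj_on_inverseI[where g = es_inv]) (rule es_inv_es_map)

text \<open>This double sum occurs both in the coproduct of the bialgebra and in the equation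
  defining \<open>ES_space\<close>; \<open>G\<close> stands for the use made of its three
  legs.\<close>

lemma ES_comult_j:
  "tsum (coact A (j h)) (\<lambda>a0 a1. tsum (translation_map A a1) (\<lambda>p q. G a0 p q)) =
    tsum (comult H h) (\<lambda>x y. tsum (comult H y) (\<lambda>p q. G (j x) (j' p) (j q)))"
  if "\<forall>a b. lin (\<lambda>x. G x a b)" "\<forall>a b. lin (\<lambda>x. G a x b)" "\<forall>a b. lin (\<lambda>x. G a b x)"
  using that by (simp add: translation_map_cleft tsum_coact_j tsum_tsum tsum_pair lin_simps lin_comp[of "G a b" for a b]
      lin_comp[of "\<lambda>x. G a x b" for a b])

lemma lin_translation_map [lin_simps]: "lin g \<Longrightarrow> lin (\<lambda>x. translation_map A (g x))"
  by (simp add: translation_map_cleft lin_simps)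

lemma ES_comult: "comult (ES_bialgebra A) t = tsum t (\<lambda>a b. tsum (coact A a) (\<lambda>a0 a1.
        tsum (translation_map A a1) (\<lambda>p q. (a0 \<otimes> p) \<otimes> (q \<otimes> b))))"
  by (simp add: ES_bialgebra_def tensor_lift_tsum lin_simps)

text \<open>Both sides are j(h_1) \<otimes> j'(h_2) \<otimes> j(h_3) \<otimes> j'(h_4), suitably
  bracketed.\<close>

lemma ES_comult_es_map: "comult (ES_bialgebra A) (es_map h) = tsum (comult H h) (\<lambda>x y. es_map x \<otimes> es_map y)"
proof -
  have "comult (ES_bialgebra A) (es_map h) = tsum (comult H h) (\<lambda>x y.
      tsum (comult H x) (\<lambda>x z. tsum (comult H z) (\<lambda>p q. (j x \<otimes> j' p) \<otimes> (j q \<otimes> j' y))))"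
    by (simp add: ES_comult es_map_def tsum_tsum tsum_pair lin_simps
        ES_comult_j[where G = "\<lambda>a0 p q. (a0 \<otimes> p) \<otimes> (q \<otimes> b)" for b])
  also have "\<dots> = tsum (comult H h) (\<lambda>x y. tsum (comult H x) (\<lambda>x z. es_map x \<otimes> (j z \<otimes> j' y)))"
    by (simp add: es_map_def tsum_out lin_simps C.coassoc[where F = "\<lambda>x p q. (j x \<otimes> j' p) \<otimes> (j q \<otimes> j' y)" for y])
  also have "\<dots> = tsum (comult H h) (\<lambda>x y. tsum (comult H y) (\<lambda>z y. es_map x \<otimes> (j z \<otimes> j' y)))"
    by (rule C.coassoc) (simp_all add: lin_simps)
  also have "\<dots> = tsum (comult H h) (\<lambda>x y. es_map x \<otimes> es_map y)"
    by (simp add: es_map_def[of "_ :: 'h"] flip: tsum_out(5))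
  finally show ?thesis .
qed

lemma unit_A_nonzero: "unit A \<noteq> 0"
  using \<phi>_unit lin_zero[OF lin_\<phi>'] by auto

text \<open>Multiplying the two legs gives a multiple of the unit; the unit is nonzero, so the
  coefficient is unique and the definite description picks it.\<close>

lemma ES_counit_es_map: "counit (ES_bialgebra A) (es_map h) = counit H h"
  by (simp add: ES_bialgebra_def tensor_lift_tsum es_map_def tsum_tsum tsum_pair j_cancel
      unit_A_nonzero lin_simps)

lemma ES_space_iff: "t \<in> ES_space A \<longleftrightarrow>
  tsum t (\<lambda>a b. tsum (coact A a) (\<lambda>a0 a1. tsum (translation_map A a1) (\<lambda>p q. a0 \<otimes> p \<otimes> q \<bullet> b))) =
  tsum t (\<lambda>a b. a \<otimes> b \<otimes> unit A)"
  by (simp add: ES_space_def tensor_lift_tsum lin_simps)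

lemma es_map_in_ES: "es_map h \<in> ES_space A"
proof -
  have "tsum (es_map h) (\<lambda>a b. tsum (coact A a) (\<lambda>a0 a1. tsum (translation_map A a1) (\<lambda>p q. a0 \<otimes> p \<otimes> q \<bullet> b))) =
      tsum (comult H h) (\<lambda>x y. tsum (comult H x) (\<lambda>x z. tsum (comult H z) (\<lambda>p q. j x \<otimes> j' p \<otimes> j q \<bullet> j' y)))"
    by (simp add: es_map_def tsum_tsum tsum_pair lin_simps ES_comult_j[where G = "\<lambda>a0 p q. a0 \<otimes> p \<otimes> q \<bullet> b" for b])
  also have "\<dots> = tsum (comult H h) (\<lambda>x y. tsum (comult H y) (\<lambda>z y. tsum (comult H z) (\<lambda>p q. j x \<otimes> j' p \<otimes> j q \<bullet> j' y)))"
    by (rule C.coassoc) (simp_all add: lin_simps)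
  \<comment> \<open>The last two legs are grouped so that \<open>j q \<bullet> j' y\<close> cancels
    to the unit.\<close>
  also have "\<dots> = tsum (comult H h) (\<lambda>x y. tsum (comult H y) (\<lambda>p y. tsum (comult H y) (\<lambda>q y. j x \<otimes> j' p \<otimes> j q \<bullet> j' y)))"
    by (subst C.coassoc) (simp_all add: lin_simps)
  also have "\<dots> = tsum (es_map h) (\<lambda>a b. a \<otimes> b \<otimes> unit A)"
    by (simp add: tsum_j_cancel(1)[where F = "\<lambda>w. a \<otimes> b \<otimes> w" for a b] C.counit_right lin_simps
        es_map_def tsum_tsum tsum_pair)
  finally show ?thesis by (simp add: ES_space_iff)
qed

text \<open>Write a as \<open>j (j_inv a)\<close> and apply \<open>\<phi>\<close> to the third leg
  of the equation defining \<open>ES_space\<close>: one side becomes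
  \<open>es_map (es_inv t)\<close>, the other \<open>t\<close>.\<close>

lemma es_map_es_inv: "t \<in> ES_space A \<Longrightarrow> es_map (es_inv t) = t"
proof -
  assume t: "t \<in> ES_space A"
  let ?L = "\<lambda>t. tsum t (\<lambda>a s. tsum s (\<lambda>b c. \<phi> c *\<^sub>C (a \<otimes> b)))"
  have L: "lin ?L" "\<And>a b c. ?L (a \<otimes> b \<otimes> c) = \<phi> c *\<^sub>C (a \<otimes> b)"
    by (simp_all add: lin_simps tsum_pair)
  have "es_map (es_inv t) = tsum t (\<lambda>a b. tsum (comult H (j_inv a)) (\<lambda>x y. tsum (comult H x) (\<lambda>x z.
      \<phi> (j y \<bullet> b) *\<^sub>C (j x \<otimes> j' z))))"
    by (simp add: es_inv_def lin_tsum_out[OF lin_es_map(1)] lin_scale[OF lin_es_map(1)]) (simp add: es_map_def tsum_out)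
  also have "\<dots> = tsum t (\<lambda>a b. tsum (comult H (j_inv a)) (\<lambda>x z. tsum (comult H z) (\<lambda>z y.
      \<phi> (j y \<bullet> b) *\<^sub>C (j x \<otimes> j' z))))"
    by (subst C.coassoc) (simp_all add: lin_simps)
  also have "\<dots> = tsum t (\<lambda>a b. ?L (tsum (coact A (j (j_inv a))) (\<lambda>a0 a1.
      tsum (translation_map A a1) (\<lambda>p q. a0 \<otimes> p \<otimes> q \<bullet> b))))"
    by (subst ES_comult_j) (simp_all only: lin_tsum_out[OF L(1)] L(2), simp_all add: lin_simps)
  also have "\<dots> = ?L (tsum t (\<lambda>a b. tsum (coact A a) (\<lambda>a0 a1. tsum (translation_map A a1) (\<lambda>p q. a0 \<otimes> p \<otimes> q \<bullet> b))))"
    by (simp only: j_j_inv lin_tsum_out[OF L(1)])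
  also have "\<dots> = ?L (tsum t (\<lambda>a b. a \<otimes> b \<otimes> unit A))"
    using t by (simp only: ES_space_iff)
  also have "\<dots> = t"
    by (simp only: lin_tsum_out[OF L(1)] L(2)) (simp add: \<phi>_unit scaleC_one tsum_tensor)
  finally show ?thesis .
qed

lemma range_es_map: "range es_map = ES_space A"
  using es_map_in_ES es_map_es_inv by (metis image_subsetI rangeI subsetI subset_antisym)

section \<open>The twisted Hopf algebra\<close>

text \<open>The right side is the convolution of the twisted product in the first leg with that in
  the second. The inner \<open>sig'\<close> and \<open>sig\<close> meet and cancel, and the two
  untwisted products combine to the coproduct of one.\<close>

lemma comult_twisted: "comult H (twisted (h \<otimes> g)) =
  tsum (comult H h) (\<lambda>a b. tsum (comult H g) (\<lambda>c d. twisted (a \<otimes> c) \<otimes> twisted (b \<otimes> d)))"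
proof -
  let ?l = "\<lambda>F t. F t \<otimes> unit H" and ?r = "\<lambda>F t. unit H \<otimes> F t"
  have l: "?l twisted = HHHH.star (HHHH.scal sig) (HHHH.star (?l mult_lin) (HHHH.scal sig'))"
    by (rule ext) (simp add: twisted_def HHHH.conv_prod_scal_left HHHH.conv_prod_scal_right HHH.conv_prod_scal_left HHH.conv_prod_scal_right
        tsum_out tensor_scale_left)
  have r: "?r twisted = HHHH.star (HHHH.scal sig) (HHHH.star (?r mult_lin) (HHHH.scal sig'))"
    by (rule ext) (simp add: twisted_def HHHH.conv_prod_scal_left HHHH.conv_prod_scal_right HHH.conv_prod_scal_left HHH.conv_prod_scal_right
        tsum_out tensor_scale_right)
  have times: "tensor_times (mult H) (mult H) (x \<otimes> y) (x' \<otimes> y') = x \<cdot> x' \<otimes> y \<cdot> y'" for x y x' y'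
    by (rule tensor_times_pair) unfold_locales
  have "tsum (comult H h) (\<lambda>a b. tsum (comult H g) (\<lambda>c d. twisted (a \<otimes> c) \<otimes> twisted (b \<otimes> d))) =
      HHHH.star (?l twisted) (?r twisted) (h \<otimes> g)"
    by (simp add: conv_prod_def tsum_comult2 times M.unit_left M.unit_right lin_simps)
  also have "HHHH.star (?l twisted) (?r twisted) =
      HHHH.star (HHHH.scal sig) (HHHH.star (HHHH.star (?l mult_lin) (?r mult_lin)) (HHHH.scal sig'))"
    by (simp add: l r HHHH.conv_prod_assoc lin_simps HHHH.conv_prod_cancel_left[OF HHHH.scal_inverse[OF sig_inverse(2)]])
  also have "HHHH.star (?l mult_lin) (?r mult_lin) = (\<lambda>t. comult H (mult_lin t))"
    by (rule fun_tensor_ext) (simp_all add: conv_prod_def tsum_comult2 times UV_pair M.unit_left M.unit_right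
        comult_mult lin_simps)
  also have "HHHH.star (HHHH.scal sig) (HHHH.star (\<lambda>t. comult H (mult_lin t)) (HHHH.scal sig')) (h \<otimes> g) =
      comult H (twisted (h \<otimes> g))"
    unfolding lin_twisted_out[OF C.lin_comult] HHHH.conv_prod_scal_left HHHH.conv_prod_scal_right
    by (simp add: tsum_out scaleC_scaleC)
  finally show ?thesis by simp
qed

text \<open>The counit turns the untwisted product into \<open>counit2\<close>, leaving
  \<open>sig\<close> convolved with \<open>sig'\<close>.\<close>

lemma counit_twisted: "counit H (twisted t) = counit2 H t"
proof -
  have mult_lin: "counit H (mult_lin t) = counit2 H t" for t
    by (rule tensor_ext[where f = "\<lambda>t. counit H (mult_lin t)"])
      (simp_all add: UV_pair counit_mult counit2_pair lin_simps)
  have "counit H (twisted t) = tsum (comult2 H t) (\<lambda>x y. sig x * tsum (comult2 H y) (\<lambda>y z. counit2 H y *\<^sub>C sig' z))"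
    unfolding lin_twisted_out[OF C.lin_counit] by (simp add: mult_lin tsum_out ac_simps)
  also have "\<dots> = counit2 H t"
    unfolding C2.counit_left[OF lin_sig'(1)] using fun_cong[OF sig_inverse(1), of t] by (simp add: conv_prod_def)
  finally show ?thesis .
qed

section \<open>The antipode of the twist\<close>

definition u_form :: "'h \<Rightarrow> complex" where
  "u_form h = tsum (comult H h) (\<lambda>x y. sig (x \<otimes> S y))"

definition v_form :: "'h \<Rightarrow> complex" where
  "v_form h = tsum (comult H h) (\<lambda>x y. sig' (S x \<otimes> y))"

lemma lin_u_v_form [lin_simps]: "lin u_form" "lin v_form" "lin g \<Longrightarrow> lin (\<lambda>x. u_form (g x))" "lin g \<Longrightarrow> lin (\<lambda>x. v_form (g x))"
  unfolding u_form_def v_form_def by (simp_all add: lin_simps)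

text \<open>By \<open>j_mult\<close>, and since S reverses the coproduct, j(h_1) j(S h_2) is
  sig(h_1, S h_4) j(h_2 S h_3); the antipode identity removes the last factor.\<close>

lemma j_star_j_S: "HA.star j (\<lambda>h. j (S h)) = HA.scal u_form"
proof
  fix h
  have "HA.star j (\<lambda>h. j (S h)) h = tsum (comult H h) (\<lambda>x y. tsum (comult H x) (\<lambda>x1 x2.
      tsum (comult H y) (\<lambda>y1 y2. sig (x1 \<otimes> S y2) *\<^sub>C j (x2 \<cdot> S y1))))"
    by (simp add: conv_prod_def j_mult tsum_comult_S lin_simps)
  also have "\<dots> = tsum (comult H h) (\<lambda>x y. tsum (comult H y) (\<lambda>y z.
      tsum (comult H z) (\<lambda>y1 y2. sig (x \<otimes> S y2) *\<^sub>C j (y \<cdot> S y1))))"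
    by (rule C.coassoc) (simp_all add: lin_simps)
  also have "\<dots> = tsum (comult H h) (\<lambda>x y. tsum (comult H y) (\<lambda>y z.
      tsum (comult H y) (\<lambda>y y1. sig (x \<otimes> S z) *\<^sub>C j (y \<cdot> S y1))))"
    by (subst C.coassoc) (simp_all add: lin_simps)
  also have "\<dots> = tsum (comult H h) (\<lambda>x y. tsum (comult H y) (\<lambda>y z. counit H y *\<^sub>C sig (x \<otimes> S z) *\<^sub>C unit A))"
    by (simp add: tsum_antipode_right[where F = "\<lambda>w. c *\<^sub>C j w" for c] lin_simps j_unit)
  also have "\<dots> = HA.scal u_form h"
    by (subst C.counit_left) (simp_all add: lin_simps u_form_def tsum_out)
  finally show "HA.star j (\<lambda>h. j (S h)) h = HA.scal u_form h" .
qed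

text \<open>As S reverses the coproduct, the triple product is \<open>sig'\<close> convolved with
  \<open>U\<close> at S h_1 \<otimes> h_2, which is j(S(h_1) h_2) by \<open>V_eq\<close>.\<close>

lemma j_S_v_form_j: "HA.star (HA.star (\<lambda>h. j (S h)) (HA.scal v_form)) j = HA.one"
proof
  fix h
  have "HA.star (HA.star (\<lambda>h. j (S h)) (HA.scal v_form)) j h = tsum (comult H h) (\<lambda>a b.
      tsum (comult H a) (\<lambda>a c. tsum (comult H c) (\<lambda>x y. sig' (S x \<otimes> y) *\<^sub>C (j (S a) \<bullet> j b))))"
    by (subst conv_prod_def) (simp only: HA.conv_prod_scal_right, simp add: A.mult_tsum A.mult_scale v_form_def tsum_out)
  also have "\<dots> = tsum (comult H h) (\<lambda>a b.
      tsum (comult H a) (\<lambda>a c. tsum (comult H a) (\<lambda>a x. sig' (S x \<otimes> c) *\<^sub>C (j (S a) \<bullet> j b))))"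
    by (subst C.coassoc) (simp_all add: lin_simps)
  also have "\<dots> = tsum (comult H h) (\<lambda>a b.
      tsum (comult H b) (\<lambda>c b. tsum (comult H a) (\<lambda>a x. sig' (S x \<otimes> c) *\<^sub>C (j (S a) \<bullet> j b))))"
    by (rule C.coassoc) (simp_all add: lin_simps)
  also have "\<dots> = tsum (comult H h) (\<lambda>a b. HHA.star (HHA.scal sig') U (S a \<otimes> b))"
    by (subst tsum_commute)
      (simp add: HHA.conv_prod_scal_left tsum_comult2 tsum_comult_S UV_pair lin_simps)
  also have "\<dots> = tsum (comult H h) (\<lambda>a b. j (S a \<cdot> b))"
    by (simp add: UV_pair flip: V_eq)
  also have "\<dots> = HA.one h"
    by (simp add: tsum_antipode_left j_unit lin_simps)
  finally show "HA.star (HA.star (\<lambda>h. j (S h)) (HA.scal v_form)) j h = HA.one h" .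
qed

lemma j_S_eq: "(\<lambda>h. j (S h)) = HA.star j' (HA.scal u_form)"
  using HA.conv_prod_cancel_left[OF j_inverse(2), of "\<lambda>h. j (S h)"] by (simp add: j_star_j_S lin_simps)

lemma j'_eq: "j' = HA.star (\<lambda>h. j (S h)) (HA.scal v_form)"
  by (rule HA.conv_prod_inverse_unique[OF j_S_v_form_j j_inverse(1), symmetric]) (simp_all add: lin_simps)

lemma u_v_form_inverse: "conv_prod (comult H) (*) u_form v_form = counit H" "conv_prod (comult H) (*) v_form u_form = counit H"
proof -
  have "HA.one = HA.star j (HA.star (\<lambda>h. j (S h)) (HA.scal v_form))"
    by (simp add: j_inverse flip: j'_eq)
  also have "\<dots> = HA.star (HA.star j (\<lambda>h. j (S h))) (HA.scal v_form)"
    by (rule HA.conv_prod_assoc[symmetric]) (simp_all add: lin_simps)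
  also have "\<dots> = HA.scal (conv_prod (comult H) (*) u_form v_form)"
    by (simp add: j_star_j_S HA.conv_prod_scal)
  finally show "conv_prod (comult H) (*) u_form v_form = counit H"
    using unit_A_nonzero by (simp add: fun_eq_iff)
  have "(\<lambda>h. j (S h)) = HA.star (HA.star (\<lambda>h. j (S h)) (HA.scal v_form)) (HA.scal u_form)"
    by (subst j'_eq[symmetric]) (rule j_S_eq)
  also have "\<dots> = HA.star (\<lambda>h. j (S h)) (HA.scal (conv_prod (comult H) (*) v_form u_form))"
    by (simp add: HA.conv_prod_assoc HA.conv_prod_scal lin_simps)
  finally have eq: "(\<lambda>h. j (S h)) = HA.star (\<lambda>h. j (S h)) (HA.scal (conv_prod (comult H) (*) v_form u_form))" .
  show "conv_prod (comult H) (*) v_form u_form = counit H"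
  proof
    fix h
    \<comment> \<open>Applying \<open>lam\<close> strips \<open>j (S h)\<close> off both sides of
      \<open>eq\<close>, since \<open>lam_j\<close> and \<open>counit_S\<close> evaluate it to the
      counit.\<close>
    have "counit H h = lam (HA.star (\<lambda>h. j (S h)) (HA.scal (conv_prod (comult H) (*) v_form u_form)) h)"
      using fun_cong[OF eq, of h] lam_j[of "S h"] by (simp add: counit_S)
    also have "\<dots> = tsum (comult H h) (\<lambda>a b. counit H a *\<^sub>C conv_prod (comult H) (*) v_form u_form b)"
      by (simp only: HA.conv_prod_scal_right) (simp add: lin_tsum_out[OF lin_lam(1)] lin_scale[OF lin_lam(1)] lam_j counit_S mult.commute)
    also have "\<dots> = conv_prod (comult H) (*) v_form u_form h"
      by (rule C.counit_left) (simp add: lin_simps)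
    finally show "conv_prod (comult H) (*) v_form u_form h = counit H h" ..
  qed
qed

definition twisted_antipode :: "'h \<Rightarrow> 'h" where
  "twisted_antipode h = tsum (comult H h) (\<lambda>x y. tsum (comult H y) (\<lambda>y z. (u_form x * v_form z) *\<^sub>C S y))"

lemma lin_twisted_antipode [lin_simps]: "lin twisted_antipode" "lin g \<Longrightarrow> lin (\<lambda>x. twisted_antipode (g x))"
  unfolding twisted_antipode_def by (simp_all add: lin_simps)

abbreviation (input) "inl F \<equiv> (\<lambda>h. F h \<otimes> unit A)"
abbreviation (input) "inr F \<equiv> (\<lambda>h. unit A \<otimes> F h)"

text \<open>The reversal of the coproduct by S and that of the product in A^op offset each
  other.\<close>

lemma inr_inverse:
  "HE.star (inr (\<lambda>h. j' (S h))) (inr (\<lambda>h. j (S h))) = HE.one"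
  "HE.star (inr (\<lambda>h. j (S h))) (inr (\<lambda>h. j' (S h))) = HE.one"
  by (simp_all add: fun_eq_iff conv_prod_def edot_pair A.unit_left tensor_scale_right counit_S lin_simps j_cancel
      tsum_comult_S[where F = "\<lambda>x y. j x \<bullet> j' y", symmetric]
      tsum_comult_S[where F = "\<lambda>x y. j' x \<bullet> j y", symmetric] flip: tsum_out(5))

lemma inl_inverse: "HE.star (inl j) (inl j') = HE.one" "HE.star (inl j') (inl j) = HE.one"
  by (simp_all add: fun_eq_iff conv_prod_def edot_pair A.unit_left tensor_scale_left j_cancel flip: tsum_out(6))

text \<open>The map \<open>es_map\<close> after S has legs j S and j' S. By \<open>j_S_eq\<close>
  the former is j' convolved with \<open>u_form\<close>, and this trailing \<open>u_form\<close>
  cancels \<open>v_form\<close>.\<close>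

lemma es_map_antipode: "(\<lambda>h. es_map (twisted_antipode h)) =
    HE.star (HE.scal u_form) (HE.star (inr (\<lambda>h. j' (S h))) (inl j'))"
proof -
  have "(\<lambda>h. es_map (twisted_antipode h)) = HE.star (HE.scal u_form) (HE.star (\<lambda>h. es_map (S h)) (HE.scal v_form))"
    by (simp add: fun_eq_iff twisted_antipode_def HE.conv_prod_scal_left HE.conv_prod_scal_right
        lin_tsum_out[OF lin_es_map(1)]
        lin_scale[OF lin_es_map(1)] tsum_out scaleC_scaleC)
  also have "(\<lambda>h. es_map (S h)) = HE.star (inr (\<lambda>h. j' (S h))) (inl (\<lambda>h. j (S h)))"
    by (simp add: fun_eq_iff es_map_def tsum_comult_S conv_prod_def edot_pair A.unit_left A.unit_right lin_simps)
  also have "inl (\<lambda>h. j (S h)) = HE.star (inl j') (HE.scal u_form)"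
    by (simp add: fun_eq_iff fun_cong[OF j_S_eq] HE.conv_prod_scal_right HA.conv_prod_scal_right tsum_out tensor_scale_left)
  finally show ?thesis
    by (simp add: HE.conv_prod_assoc lin_simps HE.scal_inverse[OF u_v_form_inverse(1)] HE.conv_prod_one_right)
qed

lemma es_map_star: "es_map = HE.star (inl j) (inr j')"
  by (simp add: fun_eq_iff es_map_def conv_prod_def edot_pair A.unit_left A.unit_right)

lemma inr_j': "inr j' = HE.star (inr (\<lambda>h. j (S h))) (HE.scal v_form)"
proof
  fix h
  show "inr j' h = HE.star (inr (\<lambda>h. j (S h))) (HE.scal v_form) h"
    by (subst j'_eq) (simp add: HE.conv_prod_scal_right HA.conv_prod_scal_right tsum_out tensor_scale_right)
qed

text \<open>With \<open>es_map\<close> written as j in the first leg, j S in the second and a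
  trailing \<open>v_form\<close>, all factors cancel from the middle outwards.\<close>

lemma es_map_antipode_inverse:
  "HE.star (\<lambda>h. es_map (twisted_antipode h)) es_map = HE.one"
  "HE.star es_map (\<lambda>h. es_map (twisted_antipode h)) = HE.one"
proof -
  show "HE.star (\<lambda>h. es_map (twisted_antipode h)) es_map = HE.one"
    unfolding es_map_antipode unfolding es_map_star inr_j'
    by (simp add: HE.conv_prod_assoc lin_simps HE.conv_prod_cancel_left[OF inl_inverse(2)]
        HE.conv_prod_cancel_left[OF inr_inverse(1)] HE.scal_inverse[OF u_v_form_inverse(1)])
  show "HE.star es_map (\<lambda>h. es_map (twisted_antipode h)) = HE.one"
    unfolding es_map_antipode unfolding es_map_star inr_j'
    by (simp add: HE.conv_prod_assoc lin_simps HE.conv_prod_cancel_left[OF inr_inverse(2)]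
        HE.conv_prod_cancel_left[OF HE.scal_inverse[OF u_v_form_inverse(2)]] inl_inverse)
qed

section \<open>Hopf algebra axioms for the twist\<close>

lemma twist_simps: "mult (twist H sig) x y = twisted (x \<otimes> y)" "unit (twist H sig) = unit H"
  "comult (twist H sig) = comult H" "counit (twist H sig) = counit H"
  by (simp_all add: twist_def twisted_times_eq)

lemma es_map_eqI: "es_map x = es_map y \<Longrightarrow> x = y"
  using inj_es_map by (simp add: inj_eq)

lemma algebra_twist: "algebra_on UNIV (twist H sig)"
  unfolding algebra_on_def twist_simps
  by (auto intro!: es_map_eqI simp: es_map_twisted es_map_unit E.mult_assoc E.unit_left E.unit_right bilinear_on_def lin_simps)

lemma coalgebra_twist: "coalgebra_on UNIV (twist H sig)"
  using bialgebra unfolding bialgebra_on_def coalgebra_on_def twist_simps by blast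

lemma hopf_twist: "hopf_algebra (twist H sig) twisted_antipode"
proof -
  have lW: "lin (\<lambda>x. mult (twist H sig) x y)" "lin (mult (twist H sig) x)" for x y
    using algebra_twist by (auto simp: algebra_on_def bilinear_on_def)
  have "bialgebra_on UNIV (twist H sig)"
    using algebra_twist coalgebra_twist unfolding bialgebra_on_def
    by (simp add: tensor_times_tsum lW lin_simps)
      (simp add: twist_simps comult_twisted comult_unit counit_twisted counit2_pair counit_unit)
  \<comment> \<open>These are the identities of \<open>es_map_antipode_inverse\<close>, pulled back
    along the injective \<open>es_map\<close>.\<close>
  moreover have "tsum (comult H x) (\<lambda>y z. twisted (twisted_antipode y \<otimes> z)) = counit H x *\<^sub>C unit H"
    "tsum (comult H x) (\<lambda>y z. twisted (y \<otimes> twisted_antipode z)) = counit H x *\<^sub>C unit H" for x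
    using fun_cong[OF es_map_antipode_inverse(1), of x] fun_cong[OF es_map_antipode_inverse(2), of x]
    by (auto intro!: es_map_eqI simp: lin_tsum_out[OF lin_es_map(1)] lin_scale[OF lin_es_map(1)] es_map_twisted es_map_unit conv_prod_def)
  moreover have "mult (twist H sig) = (\<lambda>x y. twisted (x \<otimes> y))"
    by (simp add: fun_eq_iff twist_simps)
  ultimately show ?thesis
    unfolding hopf_algebra_on_def by (simp add: twist_simps(2-) tensor_lift_tsum lin_simps)
qed

end

section \<open>Transport of structure\<close>

text \<open>The chosen representation of \<open>t\<close> is mapped to one by elements of
  \<open>V\<close>, on which the relative lift can be evaluated.\<close>

lemma tensor_lift_on_tsum:
  assumes "complex_vector.subspace V" "bilinear_on V V F" "\<And>x. f x \<in> V" "\<And>x. g x \<in> V"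
  shows "tensor_lift_on V V F (tsum t (\<lambda>x y. f x \<otimes> g y)) = tsum t (\<lambda>x y. F (f x) (g y))"
proof -
  let ?xs = "map (\<lambda>(x, y). (f x, g y)) (tensor_rep t)"
  have "tensor_lift_on V V F (pure_sum ?xs) = (\<Sum>(x, y)\<leftarrow>?xs. F x y)"
    by (rule tensor_lift_on_pure_sum) (use assms in auto)
  then show ?thesis by (simp add: tsum_def case_prod_unfold comp_def)
qed

lemma tsum_in_tensor_space:
  assumes "\<And>x. f x \<in> V" "\<And>x. g x \<in> W"
  shows "tsum t (\<lambda>x y. f x \<otimes> g y) \<in> tensor_space V W"
  unfolding tensor_space_def
  by (rule CollectI, rule exI[of _ "map (\<lambda>(x, y). (f x, g y)) (tensor_rep t)"])
    (use assms in \<open>auto simp: tsum_def case_prod_unfold comp_def\<close>)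

text \<open>The assumptions say that \<open>f\<close> is injective and intertwines the operations;
  that \<open>B\<close> is a Hopf algebra on \<open>range f\<close> is a conclusion. In the
  application \<open>f\<close> is \<open>es_map\<close>, with range
  \<open>ES_space A\<close>.\<close>

locale hopf_transport = hopf C T
  for C :: "('w::complex_vector, 'y) bialgebra_scheme" and T :: "'w \<Rightarrow> 'w" +
  fixes B :: "('v::complex_vector, 'z) bialgebra_scheme" and f :: "'w \<Rightarrow> 'v"
  assumes lin_f': "lin f" and inj_f: "inj f"
    and mult_f: "mult B (f x) (f y) = f (mult C x y)" and unit_f: "unit B = f (unit C)"
    and comult_f: "comult B (f x) = tsum (comult C x) (\<lambda>a b. f a \<otimes> f b)"
    and counit_f: "counit B (f x) = counit C x"
begin

lemma lin_f [lin_simps]: "lin f" "lin g \<Longrightarrow> lin (\<lambda>x. f (g x))"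
  using lin_f' by (auto intro: lin_comp)

text \<open>Elements of the range are values of the linear \<open>f\<close>, so relative notions
  become ordinary ones after composing with \<open>f\<close>.\<close>

lemma linear_on_range: "linear_on (range f) g \<longleftrightarrow> lin (\<lambda>x. g (f x))"
  by (simp add: linear_on_def flip: lin_add[OF lin_f'] lin_scale[OF lin_f'])

lemma bilinear_on_range: "bilinear_on (range f) (range f) g \<longleftrightarrow> bilin (\<lambda>x y. g (f x) (f y))"
  by (simp add: bilinear_on_def linear_on_range)

lemma subspace_range: "complex_vector.subspace (range f)"
  unfolding complex_vector.subspace_def using rangeI[of f 0]
  by (auto simp: lin_zero[OF lin_f'] simp flip: lin_add[OF lin_f'] lin_scale[OF lin_f'])

lemma lift_range: "bilin (\<lambda>x y. F (f x) (f y)) \<Longrightarrow>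
    tensor_lift_on (range f) (range f) F (comult B (f x)) = tsum (comult C x) (\<lambda>a b. F (f a) (f b))"
  by (simp only: comult_f) (rule tensor_lift_on_tsum, simp_all add: subspace_range bilinear_on_range)

lemma tensor_times_range:
  "tensor_times_on (range f) (range f) (mult B) (mult B) (comult B (f x)) (comult B (f y)) =
    tsum (comult C x) (\<lambda>a b. tsum (comult C y) (\<lambda>c d. f (mult C a c) \<otimes> f (mult C b d)))"
proof -
  have "tensor_lift_on (range f) (range f) (\<lambda>x' y'. mult B (f a) x' \<otimes> mult B (f b) y') (comult B (f y)) =
      tsum (comult C y) (\<lambda>c d. f (mult C a c) \<otimes> f (mult C b d))" for a b
    by (subst lift_range) (simp_all add: mult_f lin_simps)
  then show ?thesis
    unfolding tensor_times_on_def by (subst lift_range) (simp_all add: lin_simps)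
qed

lemma algebra_range: "algebra_on (range f) B"
  unfolding algebra_on_def
  by (auto simp: subspace_range bilinear_on_range mult_f unit_f M.mult_assoc M.unit_left M.unit_right lin_simps)

lemma coalgebra_range: "coalgebra_on (range f) B"
proof -
  have "tensor_assoc (tensor_map_on (range f) (range f) (comult B) id (comult B (f x))) =
      tensor_map_on (range f) (range f) id (comult B) (comult B (f x))" for x
  proof -
    have "tensor_assoc (tensor_map_on (range f) (range f) (comult B) id (comult B (f x))) =
        tsum (comult C x) (\<lambda>a b. tsum (comult C a) (\<lambda>c d. f c \<otimes> f d \<otimes> f b))"
      unfolding tensor_map_on_def
      by (subst lift_range) (simp_all add: comult_f tensor_assoc_tsum tsum_tsum tsum_pair lin_simps)
    also have "\<dots> = tsum (comult C x) (\<lambda>a b. tsum (comult C b) (\<lambda>c d. f a \<otimes> f c \<otimes> f d))"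
      by (rule C.coassoc) (simp_all add: lin_simps)
    also have "\<dots> = tensor_map_on (range f) (range f) id (comult B) (comult B (f x))"
      unfolding tensor_map_on_def
      by (subst lift_range) (simp_all add: comult_f tsum_out lin_simps)
    finally show ?thesis .
  qed
  moreover have "tensor_lift_on (range f) (range f) (\<lambda>y z. counit B y *\<^sub>C z) (comult B (f x)) = f x"
    "tensor_lift_on (range f) (range f) (\<lambda>y z. counit B z *\<^sub>C y) (comult B (f x)) = f x" for x
    by (subst lift_range; simp add: counit_f lin_simps C.counit_left C.counit_right)+
  ultimately show ?thesis
    unfolding coalgebra_on_def
    by (auto simp: subspace_range linear_on_range comult_f counit_f lin_simps intro!: tsum_in_tensor_space)
qed

lemma bialgebra_range: "bialgebra_on (range f) B"
proof -
  have "comult B (mult B (f x) (f y)) =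
      tensor_times_on (range f) (range f) (mult B) (mult B) (comult B (f x)) (comult B (f y))" for x y
    unfolding tensor_times_range by (simp add: mult_f comult_f tsum_comult_mult lin_simps)
  then show ?thesis
    unfolding bialgebra_on_def
    by (auto simp: algebra_range coalgebra_range mult_f)
      (simp_all add: unit_f comult_f counit_f comult_unit counit_mult counit_unit tsum_pair lin_simps)
qed

lemma hopf_isomorphic_range: "hopf_isomorphic_on (range f) B UNIV C"
proof -
  have inv_f: "inv f (f x) = x" for x by (rule inv_f_f[OF inj_f])
  \<comment> \<open>The antipode of \<open>C\<close> transported along \<open>f\<close>, with
    \<open>inv f\<close> a true inverse on the range.\<close>
  let ?S = "\<lambda>v. f (T (inv f v))"
  have "tensor_lift_on (range f) (range f) (\<lambda>y z. mult B (?S y) z) (comult B (f x)) = counit B (f x) *\<^sub>C unit B"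
    "tensor_lift_on (range f) (range f) (\<lambda>y z. mult B y (?S z)) (comult B (f x)) = counit B (f x) *\<^sub>C unit B" for x
    by (subst lift_range; simp add: inv_f mult_f counit_f unit_f lin_simps
        antipode lin_scale[OF lin_f'] flip: lin_tsum_out[OF lin_f'])+
  then have "hopf_algebra_on (range f) B ?S"
    unfolding hopf_algebra_on_def by (auto simp: bialgebra_range linear_on_range inv_f lin_simps)
  moreover have "bij_betw (inv f) (range f) UNIV"
    using inj_f by (rule inj_imp_bij_betw_inv)
  then have "hopf_isomorphism_on (range f) B ?S UNIV C T (inv f)"
    unfolding hopf_isomorphism_on_def
    by (auto simp: linear_on_range inv_f mult_f unit_f counit_f lin_simps tensor_map_on_def lift_range tsum_tensor)
  ultimately show ?thesis
    unfolding hopf_isomorphic_on_def using hopf by blast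
qed

end

section \<open>Normalising the data of a cleft Galois object\<close>

lemma functional_exists:
  fixes v :: "'v::complex_vector"
  assumes "v \<noteq> 0"
  obtains \<phi> where "lin \<phi>" "\<phi> v = (1::complex)"
proof -
  let ?V = "range (\<lambda>c. c *\<^sub>C v)"
  have V: "complex_vector.subspace ?V"
    using complex_vector.subspace_span[of "{v}"] by (simp add: complex_vector.span_singleton)
  \<comment> \<open>The functional is the coordinate of a linear projection onto the line spanned by
    \<open>v\<close>.\<close>
  obtain p where p: "lin p" "\<And>x. p x \<in> ?V" "\<And>x. x \<in> ?V \<Longrightarrow> p x = x"
    using projection_onto_subspace[OF V] by blast
  have "\<forall>x. \<exists>c. p x = c *\<^sub>C v"
    using p(2) by blast
  from choice[OF this] obtain \<phi> where \<phi>: "\<And>x. p x = \<phi> x *\<^sub>C v"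
    by blast
  have cancel: "c *\<^sub>C v = d *\<^sub>C v \<Longrightarrow> c = d" for c d
    using assms by simp
  show thesis
  proof
    show "lin \<phi>"
    proof (rule linI; rule cancel)
      show "\<phi> (x + y) *\<^sub>C v = (\<phi> x + \<phi> y) *\<^sub>C v" for x y
        by (simp only: scaleC_add_left \<phi>[symmetric] lin_add[OF p(1)])
      show "\<phi> (c *\<^sub>C x) *\<^sub>C v = (c *\<^sub>C \<phi> x) *\<^sub>C v" for c x
        by (simp only: scaleC_complex_def scaleC_scaleC[symmetric] \<phi>[symmetric] lin_scale[OF p(1)])
    qed
    have "v \<in> ?V" by (rule range_eqI[of _ _ 1]) (simp add: scaleC_one)
    then show "\<phi> v = 1" using p(3)[of v] by (intro cancel) (simp only: \<phi>[symmetric] scaleC_one)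
  qed
qed

text \<open>By colinearity j(1) is coinvariant, hence c times the unit, and c is nonzero because
  j(1) j'(1) = 1. Dividing \<open>j\<close> by c and multiplying \<open>j'\<close> by c normalises
  the pair.\<close>

lemma (in comodule_alg) cleft_galoisE:
  assumes "galois_object H A" "cleft H A"
  obtains j j' \<phi> where "cleft_galois H S A j j' \<phi>"
proof -
  have bij: "bij_betw (\<lambda>c. c *\<^sub>C unit A) UNIV (coinvariants H A)" and inj: "inj (canonical_map A)"
    using assms(1) by (auto simp: galois_object_def bij_is_inj)
  \<comment> \<open>Injectivity of c \<mapsto> c 1 forces the unit to be nonzero, so a functional
    can take the value 1 there.\<close>
  have "(0::complex) *\<^sub>C unit A \<noteq> 1 *\<^sub>C unit A"
    using bij_betw_imp_inj_on[OF bij] by (metis UNIV_I inj_onD zero_neq_one)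
  then have "unit A \<noteq> 0" by auto
  then obtain \<phi> where \<phi>: "lin \<phi>" "\<phi> (unit A) = (1::complex)"
    by (rule functional_exists)
  obtain j j' where j: "lin j" "\<And>h. coact A (j h) = tensor_map j id (comult H h)"
    and inv: "is_convolution_inverse (comult H) (counit H) (mult A) (unit A) j j'"
    using assms(2) by (auto simp: cleft_def)
  have j': "lin j'" using inv by (simp add: is_convolution_inverse_def)
  have lins: "lin f \<Longrightarrow> lin (\<lambda>x. j (f x))" "lin f \<Longrightarrow> lin (\<lambda>x. j' (f x))" for f :: "'h \<Rightarrow> 'h"
    using j j' by (auto intro: lin_comp)
  note lins = lins j(1) j'
  have star: "tsum (comult H x) (\<lambda>a b. j a \<bullet> j' b) = counit H x *\<^sub>C unit A"
    "tsum (comult H x) (\<lambda>a b. j' a \<bullet> j b) = counit H x *\<^sub>C unit A" for x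
    using inv by (simp_all add: is_convolution_inverse_def convolution_def tensor_lift_tsum lin_simps lins)
  have coact: "coact A (j h) = tsum (comult H h) (\<lambda>x y. j x \<otimes> y)" for h
    by (simp add: j tensor_map_tsum lin_simps)
  have "coact A (j (unit H)) = j (unit H) \<otimes> unit H"
    by (simp add: coact comult_unit tsum_pair lin_simps lins)
  then have "j (unit H) \<in> coinvariants H A" by (simp add: coinvariants_def)
  then obtain c where c: "j (unit H) = c *\<^sub>C unit A"
    using bij_betw_imp_surj_on[OF bij] by blast
  have "c \<noteq> 0"
  proof
    assume "c = 0"
    \<comment> \<open>For c = 0 the identity \<open>star(1)\<close> at the unit of H would read 0 =
      \<open>unit A\<close>.\<close>
    with star(1)[of "unit H"] \<open>unit A \<noteq> 0\<close> A.mult_scale(1)[of 0 0 "j' (unit H)"] show False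
      by (simp add: c comult_unit counit_unit tsum_pair lin_simps lins scaleC_one)
  qed
  have "cleft_galois H S A (\<lambda>h. inverse c *\<^sub>C j h) (\<lambda>h. c *\<^sub>C j' h) \<phi>"
  proof
    show "HA.star (\<lambda>h. inverse c *\<^sub>C j h) (\<lambda>h. c *\<^sub>C j' h) = HA.one"
      "HA.star (\<lambda>h. c *\<^sub>C j' h) (\<lambda>h. inverse c *\<^sub>C j h) = HA.one"
      using \<open>c \<noteq> 0\<close> by (simp_all add: fun_eq_iff conv_prod_def A.mult_scale scaleC_scaleC star scaleC_one)
    show "coact A (inverse c *\<^sub>C j h) = tsum (comult H h) (\<lambda>x y. (inverse c *\<^sub>C j x) \<otimes> y)" for h
      by (simp add: lin_scale[OF lin_coact(1)] coact tsum_out tensor_scale_left)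
    show "inverse c *\<^sub>C j (unit H) = unit A"
      using \<open>c \<noteq> 0\<close> by (simp add: c scaleC_scaleC scaleC_one)
  qed (simp_all add: lin_simps lins inj \<phi>)
  then show thesis by (rule that)
qed

theorem corollary3p6:
  fixes H :: "'h::complex_vector bialgebra"
    and S :: "'h \<Rightarrow> 'h"
    and A :: "('a::complex_vector, 'h) comodule_algebra"
  assumes "hopf_algebra H S"
    and "galois_object H A"
    and "cleft H A"
  shows "\<exists>\<gamma>. invertible_normalised_2_cocycle H \<gamma> \<and>
           hopf_isomorphic_on (ES_space A) (ES_bialgebra A) UNIV (twist H \<gamma>)"
proof -
  interpret comodule_alg H S A
    using assms by unfold_locales (simp_all add: galois_object_def)
  obtain j j' \<phi> where "cleft_galois H S A j j' \<phi>"
    using assms(2,3) by (rule cleft_galoisE)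
  then interpret cleft_galois H S A j j' \<phi> .
  \<comment> \<open>Transport from the twist along \<open>es_map\<close> gives the Hopf structure on
    the coinvariants and the isomorphism at once.\<close>
  interpret tr: hopf_transport "twist H sig" twisted_antipode "ES_bialgebra A" es_map
  proof
    show "hopf_algebra (twist H sig) twisted_antipode" by (rule hopf_twist)
    show "unit (ES_bialgebra A) = es_map (unit (twist H sig))"
      by (simp add: twist_simps es_map_unit ES_bialgebra_def)
    show "mult (ES_bialgebra A) (es_map x) (es_map y) = es_map (mult (twist H sig) x y)" for x y
      by (simp add: twist_simps es_map_twisted ES_bialgebra_def)
  qed (simp_all add: lin_simps inj_es_map twist_simps ES_comult_es_map ES_counit_es_map)
  show ?thesis
    using cocycle tr.hopf_isomorphic_range by (auto simp: range_es_map)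
qed

end
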